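(* Let $d\ge 2$ and let $P$ be a $d$-dimensional polyhedron that is both simple and simplicial. Then $P$ is a $d$-simplex or a polygon ($d=2$). In particular, there exists no unbounded polyhedron of dimension $d\ge 2$ that is both simple and simplicial.
   Context: A polyhedron is the intersection of finitely many closed affine halfspaces in $\mathbb{R}^m$; a $d$-polyhedron is one of dimension $d$. Polyhedra are assumed pointed (they have at least one vertex). A $d$-polyhedron $P$ is simple if every vertex of $P$ is contained in exactly $d$ facets of $P$, and simplicial if every facet of $P$ contains exactly $d$ vertices of $P$ (both are properties of the vertex-facet incidences, and apply to unbounded polyhedra as well). *)

theory Defs
  imports "HOL-Analysis.Analysis"
begin

text \<open>
  The ambient space is an arbitrary Euclidean space; the polyhedron need not be full-dimensional
  in it. Vertices are the library's extreme points. A polyhedron has finitely many vertices and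
  facets, so the cardinalities below are genuine.
\<close>

definition pointed :: "'a::euclidean_space set \<Rightarrow> bool" where
  "pointed P \<longleftrightarrow> (\<exists>v. v extreme_point_of P)"

definition dim_polyhedron :: "nat \<Rightarrow> 'a::euclidean_space set \<Rightarrow> bool" where
  "dim_polyhedron d P \<longleftrightarrow> polyhedron P \<and> pointed P \<and> aff_dim P = int d"

definition simple_polyhedron :: "'a::euclidean_space set \<Rightarrow> bool" where
  "simple_polyhedron P \<longleftrightarrow>
     (\<forall>v. v extreme_point_of P \<longrightarrow> int (card {F. F facet_of P \<and> v \<in> F}) = aff_dim P)"

definition simplicial_polyhedron :: "'a::euclidean_space set \<Rightarrow> bool" where
  "simplicial_polyhedron P \<longleftrightarrow>
     (\<forall>F. F facet_of P \<longrightarrow> int (card {v. v extreme_point_of P \<and> v \<in> F}) = aff_dim P)"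

definition polygon :: "'a::euclidean_space set \<Rightarrow> bool" where
  "polygon P \<longleftrightarrow> polytope P \<and> aff_dim P = 2"

end

theory Submission
  imports Defs
begin

text \<open>
  Call two vertices adjacent if they share \<open>d - 1\<close> facets. Vertices adjacent to both ends of an edge
  \<open>x y\<close> are incident with all but one of the \<open>d + 1\<close> facets at \<open>x\<close> or \<open>y\<close>, so they form a clique.

  Suppose \<open>P\<close> is unbounded and order its vertices by a generic linear function that is positive on the
  recession cone. The edges descending from a vertex \<open>w\<close> span a bounded proper face with top vertex
  \<open>w\<close>. As each facet has only \<open>d\<close> vertices and a connected graph, a bounded proper \<open>k\<close>-face has only
  \<open>k + 1\<close> vertices, so the lower neighbours of \<open>w\<close> form a clique. Therefore the graph is a tree of
  cliques. A leaf clique must contain all \<open>d\<close> vertices of a facet avoiding its attaching vertex, so it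
  has \<open>d + 1\<close> vertices, and its top vertex has \<open>d\<close> descending edges. This makes \<open>P\<close> bounded.

  If \<open>P\<close> is bounded and \<open>d \<ge> 3\<close>, the vertices of each facet form a clique; cliques of facets sharing
  an edge merge into one clique of \<open>d + 1\<close> vertices, which is closed under adjacency.
\<close>

section \<open>Incidence structures with \<open>d\<close> facets per vertex and \<open>d\<close> vertices per facet\<close>

lemma finite_ex_min:
  fixes f :: "'v \<Rightarrow> 'b::linorder"
  assumes "finite A" "A \<noteq> {}"
  shows "\<exists>y \<in> A. \<forall>x \<in> A. f y \<le> f x"
proof -
  have "Min (f ` A) \<in> f ` A"
    using assms by (intro Min_in) auto
  then obtain y where y: "y \<in> A" "Min (f ` A) = f y"
    by blast
  have "f y \<le> f x" if "x \<in> A" for x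
    using Min_le[of "f ` A" "f x"] that y assms by simp
  with y show ?thesis by blast
qed

text \<open>Here \<open>V\<close> stands for the vertices, \<open>\<phi> v\<close> for the facets at
  \<open>v\<close>, and \<open>f\<close> for a generic linear function. Geometry enters through
  three axioms: facets determine a vertex, an edge has at most two vertices, and a vertex that is
  not lowest on the face cut out by \<open>S\<close> has a descending edge inside that face.\<close>

locale simple_simplicial_incidence =
  fixes V :: "'v set" and \<phi> :: "'v \<Rightarrow> 'f set" and d :: nat and f :: "'v \<Rightarrow> real"
  assumes finite_V: "finite V"
    and d_ge_2: "2 \<le> d"
    and simple: "v \<in> V \<Longrightarrow> card (\<phi> v) = d"
    and simplicial: "v \<in> V \<Longrightarrow> F \<in> \<phi> v \<Longrightarrow> card {x \<in> V. F \<in> \<phi> x} = d"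
    and vertex_determined: "x \<in> V \<Longrightarrow> y \<in> V \<Longrightarrow> \<phi> x \<subseteq> \<phi> y \<Longrightarrow> x = y"
    and edge_determined: "\<lbrakk>x \<in> V; y \<in> V; z \<in> V; F \<in> \<phi> x; \<phi> x - {F} \<subseteq> \<phi> y; \<phi> x - {F} \<subseteq> \<phi> z;
           y \<noteq> x; z \<noteq> x\<rbrakk> \<Longrightarrow> y = z"
    and f_inj: "inj_on f V"
    and descent: "\<lbrakk>w \<in> V; x \<in> V; S \<subseteq> \<phi> w; S \<subseteq> \<phi> x; f x < f w\<rbrakk> \<Longrightarrow>
           \<exists>w' \<in> V. \<exists>F \<in> \<phi> w. \<phi> w - {F} \<subseteq> \<phi> w' \<and> S \<subseteq> \<phi> w' \<and> f w' < f w"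
begin

text \<open>The one-sided formula is symmetric because both facet sets have \<open>d\<close>
  elements; see \<open>adj_sym\<close>.\<close>

definition adj :: "'v \<Rightarrow> 'v \<Rightarrow> bool" where
  "adj x y \<longleftrightarrow> x \<in> V \<and> y \<in> V \<and> x \<noteq> y \<and> (\<exists>F \<in> \<phi> x. \<phi> x - {F} \<subseteq> \<phi> y)"

text \<open>The vertices of the face cut out by the facets in \<open>S\<close>; the empty set gives
  the whole polyhedron.\<close>

definition verts_on :: "'f set \<Rightarrow> 'v set" where
  "verts_on S = {x \<in> V. S \<subseteq> \<phi> x}"

text \<open>For \<open>U\<close> the union of the facets at two adjacent vertices, this is the
  maximal clique through that edge.\<close>

definition clique_of :: "'f set \<Rightarrow> 'v set" where
  "clique_of U = {z \<in> V. \<exists>p \<in> U. \<phi> z = U - {p}}"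

definition lower_nbrs :: "'v \<Rightarrow> 'v set" where
  "lower_nbrs w = {x. adj w x \<and> f x < f w}"

section \<open>Adjacency and maximal cliques\<close>

lemma finite_phi: "v \<in> V \<Longrightarrow> finite (\<phi> v)"
  using simple[of v] d_ge_2 by (metis card.infinite not_numeral_le_zero)

lemma finite_verts_on: "finite (verts_on S)"
  by (simp add: verts_on_def finite_V)

lemma card_verts_on_facet: "v \<in> V \<Longrightarrow> F \<in> \<phi> v \<Longrightarrow> card (verts_on {F}) = d"
  using simplicial by (simp add: verts_on_def)

text \<open>Both ends have \<open>d\<close> facets, so moving along an edge exchanges exactly one
  facet \<open>F\<close> for one facet \<open>G\<close>.\<close>

lemma adjE:
  assumes "adj x y"
  obtains F G where "F \<in> \<phi> x" "F \<notin> \<phi> y" "G \<in> \<phi> y" "G \<notin> \<phi> x" "\<phi> y = insert G (\<phi> x - {F})"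
proof -
  obtain F where F: "F \<in> \<phi> x" "\<phi> x - {F} \<subseteq> \<phi> y" and V: "x \<in> V" "y \<in> V" "x \<noteq> y"
    using assms by (auto simp: adj_def)
  have Fy: "F \<notin> \<phi> y"
    using F V vertex_determined by blast
  have "card (\<phi> y - (\<phi> x - {F})) = 1"
    using F V simple d_ge_2 finite_phi by (subst card_Diff_subset) auto
  then obtain G where "\<phi> y - (\<phi> x - {F}) = {G}"
    by (auto simp: card_1_singleton_iff)
  then have "\<phi> y = insert G (\<phi> x - {F})" "G \<in> \<phi> y" "G \<notin> \<phi> x"
    using F Fy by auto
  with F Fy that show thesis by blast
qed

lemma adj_in_V: "adj x y \<Longrightarrow> x \<in> V \<and> y \<in> V \<and> x \<noteq> y"
  by (auto simp: adj_def)

lemma adj_sym: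
  assumes "adj x y"
  shows "adj y x"
proof -
  obtain F G where "G \<in> \<phi> y" "\<phi> y = insert G (\<phi> x - {F})"
    using adjE[OF assms] by metis
  then have "G \<in> \<phi> y" "\<phi> y - {G} \<subseteq> \<phi> x"
    by auto
  then show ?thesis
    using adj_in_V[OF assms] unfolding adj_def by blast
qed

lemma card_union_adj:
  assumes "adj x y"
  shows "card (\<phi> x \<union> \<phi> y) = Suc d"
proof -
  obtain F G where *: "F \<in> \<phi> x" "G \<notin> \<phi> x" "\<phi> y = insert G (\<phi> x - {F})"
    using adjE[OF assms] by metis
  then have "\<phi> x \<union> \<phi> y = insert G (\<phi> x)"
    by auto
  then show ?thesis
    using * adj_in_V[OF assms] simple finite_phi by simp
qed

text \<open>If \<open>z\<close> dropped the same facet of \<open>x\<close> as \<open>y\<close> does,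
  one edge at \<open>x\<close> would have three vertices; likewise at \<open>y\<close>. So
  \<open>z\<close> keeps both exchanged facets and misses a single common facet of \<open>x\<close>
  and \<open>y\<close>.\<close>

lemma triangle:
  assumes "adj x y" "adj x z" "adj y z"
  shows "z \<in> clique_of (\<phi> x \<union> \<phi> y)"
proof -
  obtain p q where pq: "p \<in> \<phi> x" "p \<notin> \<phi> y" "q \<in> \<phi> y" "q \<notin> \<phi> x" "\<phi> y = insert q (\<phi> x - {p})"
    using adjE[OF assms(1)] by metis
  obtain F G where FG: "F \<in> \<phi> x" "F \<notin> \<phi> z" "G \<in> \<phi> z" "G \<notin> \<phi> x" "\<phi> z = insert G (\<phi> x - {F})"
    using adjE[OF assms(2)] by metis
  obtain F' where F': "F' \<in> \<phi> y" "F' \<notin> \<phi> z" "\<phi> y - {F'} \<subseteq> \<phi> z"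
    using adjE[OF assms(3)] by (metis Diff_insert_absorb insert_Diff subset_insertI)
  have V: "x \<in> V" "y \<in> V" "z \<in> V" "x \<noteq> y" "x \<noteq> z" "y \<noteq> z"
    using assms adj_in_V by auto
  have "F \<noteq> p"
  proof
    assume "F = p"
    then have "y = z"
      using edge_determined[of x y z p] V pq FG by blast
    with V show False by simp
  qed
  moreover have "F' \<noteq> q"
  proof
    assume "F' = q"
    then have "\<phi> y - {q} \<subseteq> \<phi> x" "\<phi> y - {q} \<subseteq> \<phi> z"
      using pq F' by auto
    then have "x = z"
      using edge_determined[of y x z q] V pq by blast
    with V show False by simp
  qed
  ultimately have "\<phi> z = (\<phi> x \<union> \<phi> y) - {F}"
    using pq FG F' by auto
  then show ?thesis
    using V FG by (auto simp: clique_of_def)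
qed

lemma clique_ofD:
  assumes "x \<in> clique_of U" "y \<in> clique_of U" "x \<noteq> y"
  shows "adj x y" "\<phi> x \<union> \<phi> y = U"
proof -
  obtain p q where pq: "p \<in> U" "q \<in> U" "\<phi> x = U - {p}" "\<phi> y = U - {q}" and V: "x \<in> V" "y \<in> V"
    using assms by (auto simp: clique_of_def)
  have "p \<noteq> q"
    using assms(3) vertex_determined V pq by auto
  then show "adj x y" "\<phi> x \<union> \<phi> y = U"
    using pq V assms(3) by (auto simp: adj_def)
qed

lemma adj_clique_of:
  assumes "adj x y"
  shows "x \<in> clique_of (\<phi> x \<union> \<phi> y)" "y \<in> clique_of (\<phi> x \<union> \<phi> y)"
proof -
  obtain F G where "F \<in> \<phi> x" "G \<notin> \<phi> x" "\<phi> y = insert G (\<phi> x - {F})"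
    using adjE[OF assms] by metis
  then have "\<phi> x = (\<phi> x \<union> \<phi> y) - {G}" "\<phi> y = (\<phi> x \<union> \<phi> y) - {F}"
      "F \<in> \<phi> x \<union> \<phi> y" "G \<in> \<phi> x \<union> \<phi> y"
    by auto
  then show "x \<in> clique_of (\<phi> x \<union> \<phi> y)" "y \<in> clique_of (\<phi> x \<union> \<phi> y)"
    using adj_in_V[OF assms] unfolding clique_of_def by blast+
qed

lemma clique_of_extend:
  assumes "x \<in> clique_of U" "y \<in> clique_of U" "x \<noteq> y" "adj x z" "adj y z"
  shows "z \<in> clique_of U"
  using triangle[of x y z] clique_ofD[OF assms(1-3)] assms by simp

text \<open>Pigeonhole: the \<open>d\<close> vertices of \<open>F\<close> have distinct facet sets,
  each of the form \<open>U - {p}\<close> with \<open>p \<noteq> F\<close>, and there are only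
  \<open>d\<close> such sets.\<close>

lemma clique_of_full:
  assumes U: "card U = Suc d" "F \<in> U" and sub: "verts_on {F} \<subseteq> clique_of U"
    and card: "card (verts_on {F}) = d" and "p \<in> U" "p \<noteq> F"
  shows "\<exists>x \<in> V. \<phi> x = U - {p}"
proof -
  have inj: "inj_on \<phi> (verts_on {F})"
    using vertex_determined by (auto simp: inj_on_def verts_on_def)
  have finU: "finite U"
    using U card.infinite by fastforce
  have "inj_on (\<lambda>p. U - {p}) (U - {F})"
    by (auto simp: inj_on_def)
  then have "card ((\<lambda>p. U - {p}) ` (U - {F})) = d"
    using U finU by (simp add: card_image)
  moreover have "\<phi> ` verts_on {F} \<subseteq> (\<lambda>p. U - {p}) ` (U - {F})"
  proof (rule image_subsetI)
    fix x assume x: "x \<in> verts_on {F}"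
    then obtain p where "p \<in> U" "\<phi> x = U - {p}"
      using sub by (auto simp: clique_of_def)
    moreover have "F \<in> \<phi> x"
      using x by (simp add: verts_on_def)
    ultimately show "\<phi> x \<in> (\<lambda>p. U - {p}) ` (U - {F})"
      by blast
  qed
  ultimately have "\<phi> ` verts_on {F} = (\<lambda>p. U - {p}) ` (U - {F})"
    using card card_image[OF inj] finU by (intro card_subset_eq) auto
  then have "U - {p} \<in> \<phi> ` verts_on {F}"
    using assms by auto
  then show ?thesis
    by (auto simp: verts_on_def)
qed

lemma card_clique_of_full:
  assumes "\<And>p. p \<in> U \<Longrightarrow> \<exists>x \<in> V. \<phi> x = U - {p}"
  shows "card (clique_of U) = card U"
proof -
  have "inj_on \<phi> (clique_of U)"
    using vertex_determined by (auto simp: inj_on_def clique_of_def)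
  moreover have "\<phi> ` clique_of U = (\<lambda>p. U - {p}) ` U"
  proof (intro equalityI image_subsetI)
    fix p assume "p \<in> U"
    then show "U - {p} \<in> \<phi> ` clique_of U"
      using assms[of p] unfolding clique_of_def by blast
  qed (auto simp: clique_of_def)
  moreover have "inj_on (\<lambda>p. U - {p}) U"
    by (auto simp: inj_on_def)
  ultimately show ?thesis
    by (metis card_image)
qed

section \<open>Connectedness of faces\<close>

text \<open>Compare the lowest vertex of \<open>Y\<close> with the lowest one outside. The higher of
  the two descends along an edge of the face, and its own minimality forces that edge to the other
  side.\<close>

lemma face_connected:
  assumes Y: "Y \<subseteq> verts_on S" "Y \<noteq> {}" "Y \<noteq> verts_on S"
  shows "\<exists>y \<in> Y. \<exists>z \<in> verts_on S - Y. adj y z"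
proof -
  have step: "\<exists>w'. adj w w' \<and> w' \<in> verts_on S \<and> f w' < f w"
    if wx: "w \<in> verts_on S" "x \<in> verts_on S" "f x < f w" for w x
  proof -
    obtain w' F where w': "w' \<in> V" "F \<in> \<phi> w" "\<phi> w - {F} \<subseteq> \<phi> w'" "S \<subseteq> \<phi> w'" "f w' < f w"
      using descent[of w x S] wx unfolding verts_on_def by blast
    then have "adj w w'"
      using that unfolding adj_def verts_on_def by blast
    then show ?thesis
      using w' unfolding verts_on_def by blast
  qed
  have fin: "finite Y" "finite (verts_on S - Y)"
    using finite_subset[OF Y(1) finite_verts_on] finite_verts_on by simp_all
  obtain y where y: "y \<in> Y" "\<And>x. x \<in> Y \<Longrightarrow> f y \<le> f x"
    using finite_ex_min[OF fin(1) Y(2), of f] by blast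
  obtain z where z: "z \<in> verts_on S - Y" "\<And>x. x \<in> verts_on S - Y \<Longrightarrow> f z \<le> f x"
    using finite_ex_min[OF fin(2), of f] Y by blast
  have "f y \<noteq> f z"
    using y z Y f_inj by (auto simp: inj_on_def verts_on_def)
  then consider "f y < f z" | "f z < f y" by linarith
  then show ?thesis
  proof cases
    case 1
    then obtain w where "adj z w" "w \<in> verts_on S" "f w < f z"
      using step[of z y] y z Y by blast
    then show ?thesis
      using z adj_sym by (metis DiffI linorder_not_le)
  next
    case 2
    then obtain w where "adj y w" "w \<in> verts_on S" "f w < f y"
      using step[of y z] y z Y by blast
    then show ?thesis
      using y by (metis DiffI linorder_not_le)
  qed
qed

lemma two_vertices:
  assumes "v \<in> V"
  shows "\<exists>x \<in> V. x \<noteq> v"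
proof -
  have "\<phi> v \<noteq> {}"
    using simple[OF assms] d_ge_2 by auto
  then obtain F where "F \<in> \<phi> v"
    by blast
  then have "card (verts_on {F}) = d"
    using card_verts_on_facet assms by blast
  then have "\<not> verts_on {F} \<subseteq> {v}"
    using d_ge_2 card_mono[of "{v}" "verts_on {F}"] by auto
  then show ?thesis
    by (auto simp: verts_on_def)
qed

section \<open>Bounded faces and their number of vertices\<close>

text \<open>Every edge of the face cut out by \<open>S\<close> ends in a second vertex; geometrically, the face is bounded.\<close>

definition full_face :: "'f set \<Rightarrow> bool" where
  "full_face S \<longleftrightarrow> (\<forall>v \<in> verts_on S. \<forall>H \<in> \<phi> v - S. \<exists>x. adj v x \<and> \<phi> v - {H} \<subseteq> \<phi> x)"

text \<open>Each facet at \<open>v\<close> outside \<open>S\<close> gives an edge inside the face.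
  The neighbour along it misses exactly this facet of \<open>v\<close>, so different facets give
  different neighbours.\<close>

lemma full_face_card_nbrs:
  assumes "full_face S" "v \<in> verts_on S"
  shows "d - card S \<le> card {x \<in> verts_on S. adj v x}"
proof -
  have v: "v \<in> V" "S \<subseteq> \<phi> v" "finite (\<phi> v)"
    using assms finite_phi by (auto simp: verts_on_def)
  obtain g where g: "\<And>H. H \<in> \<phi> v - S \<Longrightarrow> adj v (g H) \<and> \<phi> v - {H} \<subseteq> \<phi> (g H)"
    using assms unfolding full_face_def by metis
  have gH: "H \<notin> \<phi> (g H)" if "H \<in> \<phi> v - S" for H
    using g[OF that] vertex_determined[of v "g H"] adj_in_V[of v "g H"] by blast
  have "inj_on g (\<phi> v - S)"
  proof (rule inj_onI, rule ccontr)
    fix H H' assume H: "H \<in> \<phi> v - S" "H' \<in> \<phi> v - S" "g H = g H'" "H \<noteq> H'"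
    then have "H \<in> \<phi> (g H')"
      using g[OF H(2)] by blast
    then show False
      using gH[OF H(1)] H(3) by simp
  qed
  moreover have "g ` (\<phi> v - S) \<subseteq> {x \<in> verts_on S. adj v x}"
  proof (rule image_subsetI)
    fix H assume H: "H \<in> \<phi> v - S"
    then have "S \<subseteq> \<phi> (g H)"
      using g[OF H] v by blast
    then show "g H \<in> {x \<in> verts_on S. adj v x}"
      using g[OF H] adj_in_V[of v "g H"] by (simp add: verts_on_def)
  qed
  moreover have "finite {x \<in> verts_on S. adj v x}"
    using finite_verts_on by simp
  ultimately have "card (\<phi> v - S) \<le> card {x \<in> verts_on S. adj v x}"
    using card_inj_on_le by blast
  moreover have "card (\<phi> v - S) = d - card S"
    using v simple by (simp add: card_Diff_subset finite_subset)
  ultimately show ?thesis by simp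
qed

text \<open>At most \<open>d - card S\<close> other vertices exist, and
  \<open>full_face_card_nbrs\<close> provides at least as many neighbours of
  \<open>x\<close>.\<close>

lemma full_face_clique:
  assumes full: "full_face S" and card: "card (verts_on S) \<le> Suc (d - card S)"
    and xy: "x \<in> verts_on S" "y \<in> verts_on S" "x \<noteq> y"
  shows "adj x y"
proof -
  let ?N = "{z \<in> verts_on S. adj x z}"
  have "?N \<subseteq> verts_on S - {x}"
    using adj_in_V by blast
  moreover have "card (verts_on S - {x}) \<le> card ?N"
    using full_face_card_nbrs[OF full xy(1)] card xy finite_verts_on by simp
  ultimately have "?N = verts_on S - {x}"
    using finite_verts_on by (intro card_seteq) auto
  then show ?thesis
    using xy by blast
qed

text \<open>Enlarging a connected set of vertices by an adjacent one destroys at most one common facet.\<close>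

lemma common_facets_growth:
  assumes S: "S \<subseteq> \<phi> w" "w \<in> V" and i: "i \<in> S"
  shows "card S + card (verts_on S) \<le> card {j \<in> S. verts_on {i} \<subseteq> verts_on {j}} + card (verts_on {i})"
proof -
  define C where "C Y = {j \<in> S. Y \<subseteq> verts_on {j}}" for Y
  \<comment> \<open>The vertex sets reachable while the sum of both cardinalities has not dropped. A
    maximal one is the whole facet \<open>i\<close>, since otherwise connectedness supplies one more
    vertex.\<close>
  define \<Y> where "\<Y> = {Y. verts_on S \<subseteq> Y \<and> Y \<subseteq> verts_on {i} \<and> card S + card (verts_on S) \<le> card (C Y) + card Y}"
  have finS: "finite S"
    using finite_subset[OF S(1) finite_phi[OF S(2)]] .
  have "finite \<Y>"
    by (rule finite_subset[of _ "Pow (verts_on {i})"]) (auto simp: \<Y>_def finite_verts_on)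
  moreover have "verts_on S \<in> \<Y>"
  proof -
    have "C (verts_on S) = S"
      by (auto simp: C_def verts_on_def)
    then show ?thesis
      using i by (auto simp: \<Y>_def verts_on_def)
  qed
  ultimately obtain Y where Y: "Y \<in> \<Y>" and max: "\<And>Z. Z \<in> \<Y> \<Longrightarrow> Y \<subseteq> Z \<Longrightarrow> Y = Z"
    using finite_has_maximal[of \<Y>] by blast
  have "Y = verts_on {i}"
  proof (rule ccontr)
    assume ne: "Y \<noteq> verts_on {i}"
    have "w \<in> verts_on S"
      using S by (auto simp: verts_on_def)
    then obtain y z where yz: "y \<in> Y" "z \<in> verts_on {i} - Y" "adj y z"
      using face_connected[of Y "{i}"] ne Y by (auto simp: \<Y>_def)
    obtain F where F: "\<phi> y - {F} \<subseteq> \<phi> z"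
      using yz by (auto simp: adj_def)
    have "C Y - {F} \<subseteq> C (insert z Y)"
      using F yz by (auto simp: C_def verts_on_def)
    then have "card (C Y - {F}) \<le> card (C (insert z Y))"
      using finS by (intro card_mono) (auto simp: C_def)
    then have "card (C Y) \<le> Suc (card (C (insert z Y)))"
      by (simp add: card_Diff_singleton_if split: if_splits)
    moreover have "finite Y"
      using Y finite_verts_on finite_subset by (auto simp: \<Y>_def)
    ultimately have "insert z Y \<in> \<Y>"
      using Y yz by (auto simp: \<Y>_def)
    with max yz show False by blast
  qed
  then show ?thesis
    using Y by (simp add: \<Y>_def C_def)
qed

text \<open>If the face had more vertices, every facet in \<open>S\<close> would share its vertex set with another
  one; but an edge leaving the face leaves exactly one facet in \<open>S\<close>.\<close>

lemma card_verts_on_le: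
  assumes S: "S \<subseteq> \<phi> w" "w \<in> V" "S \<noteq> {}"
  shows "card (verts_on S) \<le> Suc (d - card S)"
proof (rule ccontr)
  assume neg: "\<not> ?thesis"
  have twin: "\<exists>j \<in> S. j \<noteq> i \<and> verts_on {j} = verts_on {i}" if i: "i \<in> S" for i
  proof -
    let ?C = "{j \<in> S. verts_on {i} \<subseteq> verts_on {j}}"
    have d: "card (verts_on {j}) = d" if "j \<in> S" for j
      using card_verts_on_facet[OF S(2), of j] S(1) that by blast
    \<comment> \<open>An excess vertex makes the left side at least \<open>d + 2\<close>, so two
      facets of \<open>S\<close> contain all vertices of \<open>i\<close>; both having
      \<open>d\<close> vertices, their vertex sets agree.\<close>
    have "card S + card (verts_on S) \<le> card ?C + d"
      using common_facets_growth[OF S(1,2) i] d[OF i] by simp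
    moreover have "card S \<le> d"
      using card_mono[OF finite_phi[OF S(2)] S(1)] simple[OF S(2)] by simp
    ultimately have two: "2 \<le> card ?C"
      using neg by linarith
    have "card ?C \<le> 1" if "?C \<subseteq> {i}"
      using card_mono[OF _ that] by simp
    then have "\<not> ?C \<subseteq> {i}"
      using two by linarith
    then obtain j where j: "j \<in> S" "j \<noteq> i" "verts_on {i} \<subseteq> verts_on {j}"
      by blast
    then have "verts_on {i} = verts_on {j}"
      using d[OF i] d[OF j(1)] by (intro card_subset_eq finite_verts_on) simp_all
    with j show ?thesis by metis
  qed
  have w: "w \<in> verts_on S"
    using S(1,2) by (simp add: verts_on_def)
  \<comment> \<open>Otherwise there are only \<open>d\<close> vertices in all, every facet contains
    each of them, and two vertices have the same facets.\<close>
  have "verts_on S \<noteq> V"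
  proof
    assume eq: "verts_on S = V"
    obtain i where i: "i \<in> S" using S(3) by blast
    have V: "verts_on {i} = V"
      using eq i unfolding verts_on_def by blast
    have d: "card V = d"
      using card_verts_on_facet[OF S(2), of i] V i S(1) by auto
    obtain x where x: "x \<in> V" "x \<noteq> w"
      using two_vertices[OF S(2)] by blast
    have "F \<in> \<phi> x" if "F \<in> \<phi> w" for F
    proof -
      have "verts_on {F} = V"
        using card_verts_on_facet[OF S(2) that] d finite_V
        by (intro card_subset_eq) (auto simp: verts_on_def)
      then show ?thesis
        using x by (auto simp: verts_on_def)
    qed
    then show False
      using vertex_determined[OF S(2) x(1)] x(2) by blast
  qed
  moreover have "verts_on {} = V"
    by (simp add: verts_on_def)
  ultimately obtain y z where yz: "y \<in> verts_on S" "z \<in> V - verts_on S" "adj y z"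
    using face_connected[of "verts_on S" "{}"] w by (auto simp: verts_on_def)
  then obtain F where F: "\<phi> y - {F} \<subseteq> \<phi> z"
    by (auto simp: adj_def)
  then have "F \<in> S" "F \<notin> \<phi> z" "S - {F} \<subseteq> \<phi> z"
    using yz by (auto simp: verts_on_def)
  moreover from twin[OF \<open>F \<in> S\<close>] obtain j where "j \<in> S" "j \<noteq> F" "verts_on {j} = verts_on {F}"
    by blast
  ultimately have "z \<in> verts_on {j}" "z \<notin> verts_on {F}"
    using yz by (auto simp: verts_on_def)
  with \<open>verts_on {j} = verts_on {F}\<close> show False
    by simp
qed

section \<open>The bounded case in dimension at least three\<close>

text \<open>A facet containing two vertices of the clique has all its vertices in it. Applied to
  \<open>F\<close> this realises every \<open>U - {p}\<close> except \<open>U - {F}\<close>; a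
  second facet \<open>G\<close> realises that one. The resulting clique of \<open>d + 1\<close>
  vertices has no edge leaving it.\<close>

lemma card_V_if_edges_bounded:
  assumes full: "full_face {}" and "3 \<le> d" and "v \<in> V"
  shows "card V = Suc d"
proof -
  have full1: "full_face S" for S
    using full by (simp add: full_face_def verts_on_def)
  have clique: "adj x y" if "G \<in> \<phi> x" "G \<in> \<phi> y" "x \<in> V" "y \<in> V" "x \<noteq> y" for G x y
  proof (rule full_face_clique[OF full1])
    show "card (verts_on {G}) \<le> Suc (d - card {G})"
      using that by (intro card_verts_on_le[of _ x]) auto
  qed (use that in \<open>auto simp: verts_on_def\<close>)
  have third: "\<exists>z \<in> V. G \<in> \<phi> z \<and> z \<notin> A" if "G \<in> \<phi> x" "x \<in> V" "card A < d" "finite A" for G x A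
  proof -
    have "\<not> verts_on {G} \<subseteq> A"
      using card_mono[of A "verts_on {G}"] card_verts_on_facet[of x G] that by auto
    then show ?thesis
      by (auto simp: verts_on_def)
  qed
  have "\<phi> v \<noteq> {}"
    using simple[OF \<open>v \<in> V\<close>] d_ge_2 by auto
  then obtain F where F: "F \<in> \<phi> v"
    by blast
  obtain y where y: "y \<in> V" "F \<in> \<phi> y" "y \<noteq> v"
    using third[OF F \<open>v \<in> V\<close>, of "{v}"] d_ge_2 by auto
  have vy: "adj v y"
    using clique F y \<open>v \<in> V\<close> by blast
  define U where "U = \<phi> v \<union> \<phi> y"
  have cardU: "card U = Suc d"
    using card_union_adj[OF vy] by (simp add: U_def)
  have vyU: "v \<in> clique_of U" "y \<in> clique_of U"
    using adj_clique_of[OF vy] by (auto simp: U_def)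
  have subU: "verts_on {G} \<subseteq> clique_of U"
    if "a \<in> clique_of U" "b \<in> clique_of U" "a \<noteq> b" "G \<in> \<phi> a" "G \<in> \<phi> b" for G a b
  proof
    fix z assume "z \<in> verts_on {G}"
    then have z: "z \<in> V" "G \<in> \<phi> z"
      by (auto simp: verts_on_def)
    have "a \<in> V" "b \<in> V"
      using that by (auto simp: clique_of_def)
    then show "z \<in> clique_of U"
      using that z clique_of_extend[of a U b z] clique[of G a z] clique[of G b z] by blast
  qed
  have FU: "F \<in> U"
    using F by (simp add: U_def)
  have full_F: "\<exists>x \<in> V. \<phi> x = U - {p}" if "p \<in> U" "p \<noteq> F" for p
    using clique_of_full[OF cardU FU subU[of v y F] _ that] card_verts_on_facet[of v F] vyU y F \<open>v \<in> V\<close>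
    by blast
  have full_U: "\<exists>x \<in> V. \<phi> x = U - {p}" if p: "p \<in> U" for p
  proof (cases "p = F")
    case False
    with full_F p show ?thesis by blast
  next
    case True
    \<comment> \<open>Four distinct members of \<open>U\<close> are needed: \<open>F\<close>,
      \<open>G\<close>, and two more whose omission gives two vertices lying on \<open>G\<close>.
      This is where \<open>3 \<le> d\<close> enters; it fails for polygons.\<close>
    have no3: "\<exists>c \<in> U. c \<notin> {F, a, b}" for a b
    proof (rule ccontr)
      assume "\<not> ?thesis"
      then have "card U \<le> card {F, a, b}"
        by (intro card_mono) auto
      also have "\<dots> \<le> 3"
        by (simp add: card_insert_if)
      finally show False
        using cardU \<open>3 \<le> d\<close> by simp
    qed
    obtain G where "G \<in> U" "G \<noteq> F"
      using no3[of F F] by blast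
    moreover obtain a where "a \<in> U" "a \<notin> {F, G}"
      using no3[of G G] by blast
    moreover obtain b where "b \<in> U" "b \<notin> {F, G, a}"
      using no3[of G a] by blast
    ultimately have G: "G \<in> U" "a \<in> U" "b \<in> U" "G \<noteq> F" "a \<noteq> F" "b \<noteq> F" "a \<noteq> G" "b \<noteq> G" "a \<noteq> b"
      by auto
    obtain x z where xz: "x \<in> V" "\<phi> x = U - {a}" "z \<in> V" "\<phi> z = U - {b}"
      using full_F[OF G(2,5)] full_F[OF G(3,6)] by blast
    have "x \<in> clique_of U" "z \<in> clique_of U" "x \<noteq> z" "G \<in> \<phi> x" "G \<in> \<phi> z"
      using xz G by (auto simp: clique_of_def)
    then have "verts_on {G} \<subseteq> clique_of U" "card (verts_on {G}) = d"
      using subU card_verts_on_facet xz by blast+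
    then show ?thesis
      using clique_of_full[OF cardU G(1), of F] True G(4) FU by simp
  qed
  have "clique_of U = V"
  proof (rule ccontr)
    assume "clique_of U \<noteq> V"
    moreover have "verts_on {} = V" "clique_of U \<subseteq> V"
      by (auto simp: verts_on_def clique_of_def)
    ultimately obtain x z where xz: "x \<in> clique_of U" "z \<in> V - clique_of U" "adj x z"
      using face_connected[of "clique_of U" "{}"] vyU by auto
    obtain H where H: "H \<in> \<phi> x" "\<phi> x - {H} \<subseteq> \<phi> z"
      using xz by (auto simp: adj_def)
    obtain p where p: "p \<in> U" "\<phi> x = U - {p}" "x \<in> V"
      using xz by (auto simp: clique_of_def)
    \<comment> \<open>The edge at \<open>x\<close> that drops \<open>H\<close> already has its
      second vertex inside the clique, so \<open>z\<close> must be that vertex.\<close>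
    obtain x' where x': "x' \<in> V" "\<phi> x' = U - {H}"
      using full_U H p by blast
    have "x' = z"
    proof (rule edge_determined[of x x' z H])
      show "x' \<noteq> x" "\<phi> x - {H} \<subseteq> \<phi> x'"
        using p x' H by auto
    qed (use p x' H xz in auto)
    moreover have "x' \<in> clique_of U"
      using x' H(1) p(2) unfolding clique_of_def by blast
    ultimately show False
      using xz by simp
  qed
  then show ?thesis
    using card_clique_of_full[OF full_U] cardU by simp
qed

section \<open>The unbounded case: a leaf in the tree of cliques\<close>

text \<open>The facets in \<open>S\<close> are those containing all edges descending from \<open>w\<close>; they cut out a bounded
  face with top vertex \<open>w\<close>, so \<open>S = {}\<close> would make the whole polyhedron bounded.\<close>

lemma unbounded_incidence_impossible:
  assumes full: "\<And>w S. w \<in> V \<Longrightarrow>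
      S = {F \<in> \<phi> w. \<forall>x \<in> lower_nbrs w. \<not> \<phi> w - {F} \<subseteq> \<phi> x} \<Longrightarrow> S \<noteq> {} \<and> full_face S"
    and "v \<in> V"
  shows False
proof -
  \<comment> \<open>A facet dropped along a descending edge is not in \<open>S\<close>, so
    \<open>w\<close> and its lower neighbours all lie on the face of \<open>S\<close>. That face is
    a clique of at most \<open>d - card S + 1\<close> vertices, and \<open>S \<noteq> {}\<close>
    leaves fewer than \<open>d\<close> for the neighbours.\<close>
  have lower_clique: "adj x y \<and> card (lower_nbrs w) < d"
    if w: "w \<in> V" and xy: "x \<in> lower_nbrs w" "y \<in> insert w (lower_nbrs w)" "x \<noteq> y" for w x y
  proof -
    define S where "S = {F \<in> \<phi> w. \<forall>x \<in> lower_nbrs w. \<not> \<phi> w - {F} \<subseteq> \<phi> x}"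
    have S: "S \<noteq> {}" "full_face S" "S \<subseteq> \<phi> w"
      using full[OF w S_def] by (auto simp: S_def)
    have sub: "insert w (lower_nbrs w) \<subseteq> verts_on S"
    proof
      fix x assume "x \<in> insert w (lower_nbrs w)"
      then consider "x = w" | "x \<in> lower_nbrs w" by blast
      then show "x \<in> verts_on S"
      proof cases
        case 1
        then show ?thesis
          using w S by (simp add: verts_on_def)
      next
        case 2
        then obtain F where F: "x \<in> V" "F \<in> \<phi> w" "\<phi> w - {F} \<subseteq> \<phi> x"
          by (auto simp: lower_nbrs_def adj_def)
        then have "F \<notin> S"
          using 2 by (auto simp: S_def)
        then show ?thesis
          using F S by (auto simp: verts_on_def)
      qed
    qed
    have le: "card (verts_on S) \<le> Suc (d - card S)"
      using card_verts_on_le S w by blast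
    have "card (insert w (lower_nbrs w)) \<le> Suc (d - card S)"
      using le card_mono[OF finite_verts_on sub] by simp
    moreover have "w \<notin> lower_nbrs w" "finite (lower_nbrs w)"
      using sub finite_verts_on finite_subset by (auto simp: lower_nbrs_def)
    moreover have "0 < card S"
      using S finite_phi[OF w] finite_subset by (auto simp: card_gt_0_iff)
    ultimately have "card (lower_nbrs w) < d"
      using d_ge_2 by simp
    moreover have "adj x y"
      using full_face_clique[OF S(2) le] sub xy by blast
    ultimately show ?thesis by simp
  qed
  have fin_lower: "finite (lower_nbrs w)" for w
    by (rule finite_subset[OF _ finite_V]) (auto simp: lower_nbrs_def adj_def)
  \<comment> \<open>The choice function \<open>a\<close> picks the lowest lower neighbour, which
    plays the role of the attaching vertex; its value is arbitrary where no lower neighbour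
    exists.\<close>
  have "\<exists>x. lower_nbrs w \<noteq> {} \<longrightarrow> x \<in> lower_nbrs w \<and> (\<forall>y \<in> lower_nbrs w. f x \<le> f y)" for w
    using finite_ex_min[OF fin_lower, of w f] by blast
  then obtain a where a: "\<And>w. lower_nbrs w \<noteq> {} \<Longrightarrow> a w \<in> lower_nbrs w"
      "\<And>w y. y \<in> lower_nbrs w \<Longrightarrow> f (a w) \<le> f y"
    by (metis emptyE)
  define W where "W = {w \<in> V. lower_nbrs w \<noteq> {}}"
  have "W \<noteq> {}"
  proof -
    obtain x where "x \<in> V" "x \<noteq> v"
      using two_vertices \<open>v \<in> V\<close> by blast
    then have "f x < f v \<or> f v < f x"
      using f_inj \<open>v \<in> V\<close> by (meson inj_onD linorder_neqE)
    then obtain w y where wy: "w \<in> V" "y \<in> V" "f y < f w"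
      using \<open>x \<in> V\<close> \<open>v \<in> V\<close> by blast
    then obtain w' F where "w' \<in> V" "F \<in> \<phi> w" "\<phi> w - {F} \<subseteq> \<phi> w'" "f w' < f w"
      using descent[of w y "{}"] by blast
    then have "w' \<in> lower_nbrs w"
      using wy by (auto simp: lower_nbrs_def adj_def)
    then show ?thesis
      using wy by (auto simp: W_def)
  qed
  moreover have "finite W"
    using finite_V by (simp add: W_def)
  ultimately obtain w where w: "w \<in> W" and wmax: "\<And>x. x \<in> W \<Longrightarrow> f (a x) \<le> f (a w)"
    using finite_ex_min[of W "\<lambda>w. - f (a w)"] by auto
  have wV: "w \<in> V" and aw: "adj w (a w)" "f (a w) < f w"
    using w a by (auto simp: W_def lower_nbrs_def)
  \<comment> \<open>Maximality of \<open>a w\<close> makes the clique through \<open>w\<close> and \<open>a w\<close> a leaf: it is attached to the rest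
    of the graph only at \<open>a w\<close>. Hence a facet avoiding \<open>a w\<close> has all its vertices inside it.\<close>
  define U where "U = \<phi> w \<union> \<phi> (a w)"
  have cardU: "card U = Suc d"
    using card_union_adj[OF aw(1)] by (simp add: U_def)
  have wU: "w \<in> clique_of U" "a w \<in> clique_of U"
    using adj_clique_of[OF aw(1)] by (auto simp: U_def)
  obtain F where F: "F \<in> \<phi> w" "F \<notin> \<phi> (a w)"
    using adjE[OF aw(1)] by metis
  \<comment> \<open>A vertex of the clique below \<open>a w\<close> would be a lower neighbour of
    \<open>w\<close>. If \<open>a y\<close> differed from \<open>a w\<close>, it would be adjacent
    to both \<open>y\<close> and \<open>a w\<close>, hence lie in the clique and be a lower
    neighbour of \<open>w\<close> below \<open>a w\<close>.\<close>
  have above: "f (a w) < f y \<and> a y = a w \<and> adj y (a w)" if y: "y \<in> clique_of U" "y \<noteq> a w" for y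
  proof (cases "y = w")
    case True
    with aw show ?thesis by simp
  next
    case False
    have yw: "adj w y" and ya: "adj y (a w)" and yV: "y \<in> V"
      using clique_ofD(1) wU y False adj_in_V by blast+
    have "f y \<noteq> f (a w)"
      using f_inj y(2) yV aw(1) adj_in_V by (metis inj_onD)
    moreover have "\<not> f y < f (a w)"
      using a(2)[of y w] yw aw by (force simp: lower_nbrs_def)
    ultimately have less: "f (a w) < f y"
      by simp
    then have aly: "a w \<in> lower_nbrs y"
      using ya by (simp add: lower_nbrs_def)
    have ay: "a y \<in> lower_nbrs y" "f (a y) \<le> f (a w)"
      using a aly by blast+
    have "a y = a w"
    proof (rule ccontr)
      assume ne: "a y \<noteq> a w"
      have "adj (a w) (a y)"
        using lower_clique[OF yV aly, of "a y"] ay ne by auto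
      moreover have "adj y (a y)"
        using ay by (simp add: lower_nbrs_def)
      ultimately have "a y \<in> clique_of U"
        using clique_of_extend[OF wU(2) y(1)] y by metis
      moreover have "a y \<noteq> w"
        using ay aw by auto
      ultimately have "adj w (a y)"
        using clique_ofD(1) wU by metis
      then have "a y \<in> lower_nbrs w"
        using ay aw by (auto simp: lower_nbrs_def)
      then have "f (a w) \<le> f (a y)"
        using a by blast
      then have "f (a w) = f (a y)"
        using ay by simp
      then show False
        using ne f_inj \<open>adj (a w) (a y)\<close> adj_in_V by (metis inj_onD)
    qed
    with less ya show ?thesis by simp
  qed
  have "verts_on {F} \<subseteq> clique_of U"
  proof (rule ccontr)
    assume "\<not> ?thesis"
    moreover have "w \<in> verts_on {F} \<inter> clique_of U"
      using wU wV F by (simp add: verts_on_def)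
    ultimately obtain y z where "y \<in> verts_on {F} \<inter> clique_of U"
        "z \<in> verts_on {F} - verts_on {F} \<inter> clique_of U" and yz: "adj y z"
      using face_connected[of "verts_on {F} \<inter> clique_of U" "{F}"] by blast
    then have y: "y \<in> clique_of U" "F \<in> \<phi> y" "y \<in> V" and z: "z \<notin> clique_of U" "F \<in> \<phi> z" "z \<in> V"
      by (auto simp: verts_on_def)
    have "y \<noteq> a w" "z \<noteq> a w"
      using y z F by auto
    note ab = above[OF y(1) \<open>y \<noteq> a w\<close>]
    have "f y \<noteq> f z"
      using f_inj yz adj_in_V by (metis inj_onD)
    then consider "f z < f y" | "f y < f z" by linarith
    \<comment> \<open>An edge leaving the clique downwards ends in a lower neighbour of
      \<open>y\<close>, as is \<open>a w\<close>. Upwards, maximality of \<open>a w\<close> puts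
      \<open>a z\<close> no higher than \<open>a w\<close>; being also a lower neighbour of
      \<open>y\<close>, it equals \<open>a w\<close>. So \<open>z\<close> joins the clique either
      way.\<close>
    then have "adj (a w) z"
    proof cases
      case 1
      then have "z \<in> lower_nbrs y" "a w \<in> lower_nbrs y"
        using yz ab by (auto simp: lower_nbrs_def)
      then show ?thesis
        using lower_clique[OF y(3), of "a w" z] \<open>z \<noteq> a w\<close> by auto
    next
      case 2
      then have ylz: "y \<in> lower_nbrs z"
        using yz adj_sym by (auto simp: lower_nbrs_def)
      then have "z \<in> W" and azl: "a z \<in> lower_nbrs z"
        using z a by (auto simp: W_def)
      then have le: "f (a z) \<le> f (a w)"
        using wmax by blast
      then have "a z \<noteq> y"
        using ab by auto
      then have "adj y (a z)"
        using lower_clique[OF z(3) ylz, of "a z"] azl by auto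
      then have "a z \<in> lower_nbrs y"
        using le ab by (auto simp: lower_nbrs_def)
      then have "f (a w) \<le> f (a z)"
        using a(2)[of "a z" y] ab by simp
      then have "f (a w) = f (a z)"
        using le by simp
      then have "a z = a w"
        using f_inj \<open>adj y (a z)\<close> aw(1) adj_in_V by (metis inj_onD)
      then show ?thesis
        using azl adj_sym by (auto simp: lower_nbrs_def)
    qed
    then have "z \<in> clique_of U"
      using clique_of_extend[OF y(1) wU(2) \<open>y \<noteq> a w\<close> yz] by simp
    with z show False by simp
  qed
  then have full_F: "\<exists>x \<in> V. \<phi> x = U - {p}" if "p \<in> U" "p \<noteq> F" for p
    using clique_of_full[OF cardU, of F p] that F card_verts_on_facet[OF wV F(1)] by (auto simp: U_def)
  have full_U: "\<exists>x \<in> V. \<phi> x = U - {p}" if "p \<in> U" for p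
  proof (cases "p = F")
    case True
    \<comment> \<open>The one set not reached through the facet \<open>F\<close> belongs to the
      attaching vertex.\<close>
    then have "\<phi> (a w) = U - {p}"
      using wU(2) F by (auto simp: clique_of_def U_def)
    then show ?thesis
      using aw adj_in_V by blast
  qed (use full_F that in blast)
  have finK: "finite (clique_of U)"
    using finite_V by (simp add: clique_of_def)
  \<comment> \<open>At the top vertex of the clique, the other \<open>d\<close> members are all
    lower neighbours, against the bound in \<open>lower_clique\<close>.\<close>
  obtain t where t: "t \<in> clique_of U" "\<And>x. x \<in> clique_of U \<Longrightarrow> f x \<le> f t"
    using finite_ex_min[OF finK, of "\<lambda>x. - f x"] wU by auto
  have tV: "t \<in> V"
    using t by (simp add: clique_of_def)
  have sub: "clique_of U - {t} \<subseteq> lower_nbrs t"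
  proof
    fix x assume x: "x \<in> clique_of U - {t}"
    then have "adj t x" "f x \<le> f t"
      using t clique_ofD(1)[of t U x] by auto
    moreover have "f x \<noteq> f t"
      using f_inj \<open>adj t x\<close> adj_in_V by (metis inj_onD)
    ultimately show "x \<in> lower_nbrs t"
      by (simp add: lower_nbrs_def)
  qed
  have "d \<le> card (lower_nbrs t)"
  proof -
    have "d = card (clique_of U - {t})"
      using card_clique_of_full[OF full_U] cardU t finK by simp
    also have "\<dots> \<le> card (lower_nbrs t)"
      using sub fin_lower by (rule card_mono[rotated])
    finally show ?thesis .
  qed
  moreover have "lower_nbrs t \<noteq> {}"
    using \<open>d \<le> card (lower_nbrs t)\<close> d_ge_2 by auto
  then obtain x where "x \<in> lower_nbrs t" by blast
  moreover have "x \<noteq> t"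
    using \<open>x \<in> lower_nbrs t\<close> by (auto simp: lower_nbrs_def)
  ultimately show False
    using lower_clique[OF tV, of x t] by simp
qed

end

section \<open>Edge directions at the vertices of a simple polyhedron\<close>

text \<open>A minimal system of halfspaces is re-indexed by facets, one halfspace chosen for each.
  These suffice: a segment from a relative interior point \<open>z\<close> to a point outside leaves
  \<open>P\<close> on some facet, whose chosen inequality is strict at \<open>z\<close> and would
  have to fail at the far end. Normals parallel to the affine hull are retained.\<close>

lemma polyhedron_facet_representation:
  fixes P :: "'a::euclidean_space set"
  assumes "polyhedron P"
  obtains a b where
    "\<And>x. x \<in> P \<longleftrightarrow> x \<in> affine hull P \<and> (\<forall>F. F facet_of P \<longrightarrow> a F \<bullet> x \<le> b F)"
    "\<And>F. F facet_of P \<Longrightarrow> F = {x \<in> P. a F \<bullet> x = b F}"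
    "\<And>F x. F facet_of P \<Longrightarrow> x \<in> affine hull P \<Longrightarrow> x + a F \<in> affine hull P"
proof (cases "P = {}")
  case True
  then show thesis
    using that[of "\<lambda>_. 0" "\<lambda>_. 0"] by simp
next
  case False
  obtain H where H: "finite H" "P = affine hull P \<inter> \<Inter>H"
      "\<forall>h \<in> H. \<exists>a b. a \<noteq> 0 \<and> h = {x. a \<bullet> x \<le> b} \<and> (\<forall>x \<in> affine hull P. x + a \<in> affine hull P)"
      "\<forall>H'. H' \<subset> H \<longrightarrow> P \<subset> affine hull P \<inter> \<Inter>H'"
    using assms unfolding polyhedron_Int_affine_parallel_minimal by blast
  then obtain \<alpha> \<beta> where ab: "\<And>h. h \<in> H \<Longrightarrow> \<alpha> h \<noteq> 0 \<and> h = {x. \<alpha> h \<bullet> x \<le> \<beta> h}"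
      and par: "\<And>h x. h \<in> H \<Longrightarrow> x \<in> affine hull P \<Longrightarrow> x + \<alpha> h \<in> affine hull P"
    by metis
  have memP: "x \<in> P \<longleftrightarrow> x \<in> affine hull P \<and> (\<forall>h \<in> H. \<alpha> h \<bullet> x \<le> \<beta> h)" for x
    using H(2) ab by blast
  have facet: "F facet_of P \<longleftrightarrow> (\<exists>h. h \<in> H \<and> F = P \<inter> {x. \<alpha> h \<bullet> x = \<beta> h})" for F
    using facet_of_polyhedron_explicit[OF H(1,2) ab] H(4) by blast
  then obtain h where h: "\<And>F. F facet_of P \<Longrightarrow> h F \<in> H \<and> F = P \<inter> {x. \<alpha> (h F) \<bullet> x = \<beta> (h F)}"
    by metis
  have "rel_interior P \<noteq> {}"
    using False assms by (simp add: polyhedron_imp_convex rel_interior_eq_empty)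
  then obtain z where z: "z \<in> P" "\<And>g. g \<in> H \<Longrightarrow> \<alpha> g \<bullet> z < \<beta> g"
    using rel_interior_polyhedron_explicit[OF H(1,2) ab] H(4) by auto
  have inside: "x \<in> P" if x: "x \<in> affine hull P" "\<And>F. F facet_of P \<Longrightarrow> \<alpha> (h F) \<bullet> x \<le> \<beta> (h F)" for x
  proof (rule ccontr)
    assume "x \<notin> P"
    define T where "T = {g \<in> H. \<beta> g < \<alpha> g \<bullet> x}"
    have "T \<noteq> {}" "finite T"
      using \<open>x \<notin> P\<close> x memP H(1) by (auto simp: T_def not_le)
    \<comment> \<open>The parameter at which the segment from \<open>z\<close> to \<open>x\<close>
      meets the hyperplane of \<open>g\<close>; the smallest one gives the exit point
      \<open>y\<close>.\<close>
    define r where "r g = (\<beta> g - \<alpha> g \<bullet> z) / (\<alpha> g \<bullet> x - \<alpha> g \<bullet> z)" for g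
    obtain g where g: "g \<in> T" "\<And>k. k \<in> T \<Longrightarrow> r g \<le> r k"
      using finite_ex_min[OF \<open>finite T\<close> \<open>T \<noteq> {}\<close>, of r] by blast
    have gH: "g \<in> H" "\<beta> g < \<alpha> g \<bullet> x" "\<alpha> g \<bullet> z < \<beta> g"
      using g z by (auto simp: T_def)
    define y where "y = z + r g *\<^sub>R (x - z)"
    have r: "0 < r g" "r g < 1"
      using gH by (auto simp: r_def)
    have ay: "\<alpha> k \<bullet> y = (1 - r g) * (\<alpha> k \<bullet> z) + r g * (\<alpha> k \<bullet> x)" for k
      by (simp add: y_def inner_simps algebra_simps)
    have "\<alpha> k \<bullet> y \<le> \<beta> k" if k: "k \<in> H" for k
    proof (cases "k \<in> T")
      case True
      then have "\<beta> k < \<alpha> k \<bullet> x" by (simp add: T_def)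
      then have "0 < \<alpha> k \<bullet> x - \<alpha> k \<bullet> z"
        using z(2)[OF k] by linarith
      moreover have "r g \<le> (\<beta> k - \<alpha> k \<bullet> z) / (\<alpha> k \<bullet> x - \<alpha> k \<bullet> z)"
        using g(2)[OF True] by (simp add: r_def)
      ultimately have "r g * (\<alpha> k \<bullet> x - \<alpha> k \<bullet> z) \<le> \<beta> k - \<alpha> k \<bullet> z"
        by (simp add: pos_le_divide_eq)
      then show ?thesis
        by (simp add: ay algebra_simps)
    next
      case False
      then have "\<alpha> k \<bullet> x \<le> \<beta> k"
        using k by (simp add: T_def)
      then show ?thesis
        unfolding ay using z(2)[OF k] r by (intro convex_bound_le) auto
    qed
    moreover have "y \<in> affine hull P"
      unfolding y_def using z x hull_subset[of P affine]
      by (intro mem_affine_3_minus) auto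
    ultimately have "y \<in> P"
      using memP by blast
    have "r g * (\<alpha> g \<bullet> x - \<alpha> g \<bullet> z) = \<beta> g - \<alpha> g \<bullet> z"
      using gH by (simp add: r_def)
    then have "\<alpha> g \<bullet> y = \<beta> g"
      by (simp add: ay algebra_simps)
    define F where "F = P \<inter> {x. \<alpha> g \<bullet> x = \<beta> g}"
    have F: "F facet_of P" "y \<in> F"
      using facet gH \<open>y \<in> P\<close> \<open>\<alpha> g \<bullet> y = \<beta> g\<close> by (auto simp: F_def)
    then have "\<alpha> (h F) \<bullet> y = \<beta> (h F)"
      using h by blast
    moreover have "(1 - r g) * (\<alpha> (h F) \<bullet> z) < (1 - r g) * \<beta> (h F)"
      using z(2)[of "h F"] h[OF F(1)] r by (simp add: mult_strict_left_mono)
    moreover have "r g * (\<alpha> (h F) \<bullet> x) \<le> r g * \<beta> (h F)"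
      using x(2)[OF F(1)] r by (simp add: mult_left_mono)
    ultimately show False
      unfolding ay by (simp add: algebra_simps)
  qed
  show thesis
  proof (rule that[of "\<lambda>F. \<alpha> (h F)" "\<lambda>F. \<beta> (h F)"])
    show "x \<in> P \<longleftrightarrow> x \<in> affine hull P \<and> (\<forall>F. F facet_of P \<longrightarrow> \<alpha> (h F) \<bullet> x \<le> \<beta> (h F))" for x
      using inside memP h by blast
    show "F = {x \<in> P. \<alpha> (h F) \<bullet> x = \<beta> (h F)}" if "F facet_of P" for F
      using h[OF that] by blast
    show "x + \<alpha> (h F) \<in> affine hull P" if "F facet_of P" "x \<in> affine hull P" for F x
      using par h that by blast
  qed
qed

text \<open>Supplies one step length that respects the slacks of finitely many inequalities.\<close>

lemma finite_uniform_scaling: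
  fixes c s :: "'i \<Rightarrow> real"
  assumes "finite A" "\<And>i. i \<in> A \<Longrightarrow> 0 < s i"
  shows "\<exists>\<epsilon>>0. \<forall>i \<in> A. \<epsilon> * \<bar>c i\<bar> \<le> s i"
  using assms
proof (induction A rule: finite_induct)
  case empty
  show ?case by (intro exI[of _ 1]) simp
next
  case (insert i A)
  then obtain \<epsilon> where \<epsilon>: "0 < \<epsilon>" "\<forall>i \<in> A. \<epsilon> * \<bar>c i\<bar> \<le> s i"
    by auto
  define \<delta> where "\<delta> = min \<epsilon> (s i / (\<bar>c i\<bar> + 1))"
  have si: "0 < s i"
    using insert.prems by simp
  have "\<delta> > 0"
    using \<epsilon> si by (simp add: \<delta>_def)
  moreover have "\<delta> * \<bar>c j\<bar> \<le> s j" if "j \<in> A" for j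
  proof -
    have "\<delta> * \<bar>c j\<bar> \<le> \<epsilon> * \<bar>c j\<bar>"
      by (intro mult_right_mono) (auto simp: \<delta>_def)
    then show ?thesis
      using \<epsilon> that by fastforce
  qed
  moreover have "\<delta> * \<bar>c i\<bar> \<le> s i"
  proof -
    have "\<delta> * \<bar>c i\<bar> \<le> s i / (\<bar>c i\<bar> + 1) * (\<bar>c i\<bar> + 1)"
      using si by (intro mult_mono) (auto simp: \<delta>_def)
    then show ?thesis
      by simp
  qed
  ultimately show ?case by blast
qed

text \<open>Adding an index, the old weights handle every \<open>y\<close> with
  \<open>k i y = 0\<close>; every other \<open>y\<close> forbids a single value of the new
  weight.\<close>

lemma generic_weights:
  fixes k :: "'i \<Rightarrow> 'y \<Rightarrow> real"
  assumes "finite A" "finite D" "\<And>y. y \<in> D \<Longrightarrow> \<exists>i \<in> A. k i y \<noteq> 0"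
  shows "\<exists>w. (\<forall>i \<in> A. 0 < w i) \<and> (\<forall>y \<in> D. (\<Sum>i \<in> A. w i * k i y) \<noteq> 0)"
  using assms
proof (induction A arbitrary: D rule: finite_induct)
  case empty
  then show ?case by auto
next
  case (insert i A)
  define D' where "D' = {y \<in> D. \<exists>j \<in> A. k j y \<noteq> 0}"
  have "finite D'" "\<And>y. y \<in> D' \<Longrightarrow> \<exists>j \<in> A. k j y \<noteq> 0"
    using insert.prems(1) by (auto simp: D'_def)
  then obtain w where w: "\<And>j. j \<in> A \<Longrightarrow> 0 < w j" "\<And>y. y \<in> D' \<Longrightarrow> (\<Sum>j \<in> A. w j * k j y) \<noteq> 0"
    using insert.IH[of D'] by blast
  \<comment> \<open>Where \<open>k i y = 0\<close>, division by zero yields 0, which a positive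
    weight avoids anyway.\<close>
  define bad where "bad = (\<lambda>y. - (\<Sum>j \<in> A. w j * k j y) / k i y) ` D"
  have "infinite ({0<..} - bad)"
    using insert.prems(1) by (simp add: bad_def infinite_Ioi)
  then obtain s where s: "0 < s" "s \<notin> bad"
    by (metis Diff_iff ex_in_conv finite.emptyI greaterThan_iff)
  have sum: "(\<Sum>j \<in> insert i A. (w(i := s)) j * k j y) = s * k i y + (\<Sum>j \<in> A. w j * k j y)" for y
  proof -
    have "(\<Sum>j \<in> A. (w(i := s)) j * k j y) = (\<Sum>j \<in> A. w j * k j y)"
      using insert.hyps by (intro sum.cong) auto
    then show ?thesis
      using insert.hyps by simp
  qed
  have "s * k i y + (\<Sum>j \<in> A. w j * k j y) \<noteq> 0" if y: "y \<in> D" for y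
  proof (cases "k i y = 0")
    case True
    then have "y \<in> D'"
      using insert.prems(2)[OF y] y by (auto simp: D'_def)
    then show ?thesis
      using w(2) True by simp
  next
    case False
    have "s \<noteq> - (\<Sum>j \<in> A. w j * k j y) / k i y"
      using s(2) y by (auto simp: bad_def)
    then show ?thesis
      using False by (auto simp: field_simps)
  qed
  then show ?case
    using w(1) s(1) sum by (intro exI[of _ "w(i := s)"]) simp
qed

text \<open>Normals parallel to the affine hull move all linear algebra into the
  \<open>d\<close>-dimensional space \<open>dirs\<close>, whatever the dimension of the ambient
  space.\<close>

locale simple_facet_presentation =
  fixes P :: "'a::euclidean_space set" and d :: nat and a :: "'a set \<Rightarrow> 'a" and b :: "'a set \<Rightarrow> real"
  assumes poly: "polyhedron P"
    and aff_dim_P: "aff_dim P = int d"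
    and simple_P: "v extreme_point_of P \<Longrightarrow> card {F. F facet_of P \<and> v \<in> F} = d"
    and mem_P: "x \<in> P \<longleftrightarrow> x \<in> affine hull P \<and> (\<forall>F. F facet_of P \<longrightarrow> a F \<bullet> x \<le> b F)"
    and facet_eq: "F facet_of P \<Longrightarrow> F = {x \<in> P. a F \<bullet> x = b F}"
    and normal_parallel: "F facet_of P \<Longrightarrow> x \<in> affine hull P \<Longrightarrow> x + a F \<in> affine hull P"
begin

section \<open>Facet normals and coordinates at a vertex\<close>

definition dirs :: "'a set" where
  "dirs = {y. \<forall>x \<in> affine hull P. x + y \<in> affine hull P}"

definition facets_at :: "'a \<Rightarrow> 'a set set" where
  "facets_at v = {F. F facet_of P \<and> v \<in> F}"

definition vertices :: "'a set" where
  "vertices = {v. v extreme_point_of P}"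

lemma vertex_in_P: "v \<in> vertices \<Longrightarrow> v \<in> P"
  by (simp add: vertices_def extreme_point_of_def)

lemma finite_facets_at: "finite (facets_at v)"
  by (rule finite_subset[OF _ finite_polyhedron_facets[OF poly]]) (auto simp: facets_at_def)

lemma card_facets_at: "v \<in> vertices \<Longrightarrow> card (facets_at v) = d"
  using simple_P by (simp add: vertices_def facets_at_def)

lemma in_hull: "x \<in> P \<Longrightarrow> x \<in> affine hull P"
  by (simp add: hull_inc)

lemma facets_at_iff: "F \<in> facets_at v \<longleftrightarrow> F facet_of P \<and> v \<in> P \<and> a F \<bullet> v = b F"
  using facet_eq unfolding facets_at_def by blast

lemma slack_pos: "v \<in> P \<Longrightarrow> F facet_of P \<Longrightarrow> F \<notin> facets_at v \<Longrightarrow> a F \<bullet> v < b F"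
  using mem_P facets_at_iff by (metis order_le_less)

lemma dirs_eq: "v \<in> affine hull P \<Longrightarrow> dirs = (\<lambda>x. x - v) ` (affine hull P)"
proof (intro equalityI subsetI)
  fix y assume v: "v \<in> affine hull P" and "y \<in> dirs"
  then have "v + y \<in> affine hull P"
    by (simp add: dirs_def)
  then show "y \<in> (\<lambda>x. x - v) ` (affine hull P)"
    by (intro image_eqI[of _ _ "v + y"]) auto
next
  fix y assume v: "v \<in> affine hull P" and "y \<in> (\<lambda>x. x - v) ` (affine hull P)"
  then obtain x where x: "x \<in> affine hull P" "y = x - v"
    by blast
  then show "y \<in> dirs"
    using mem_affine_3_minus[OF affine_affine_hull _ x(1) v, of _ 1] by (auto simp: dirs_def)
qed

lemma nonempty: "P \<noteq> {}"
  using aff_dim_P by auto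

lemma subspace_dirs: "subspace dirs"
  and dim_dirs: "dim dirs = d"
proof -
  obtain v where v: "v \<in> affine hull P"
    using nonempty in_hull by blast
  show "subspace dirs"
    using dirs_eq[OF v] affine_diffs_subspace_subtract[OF affine_affine_hull v] by simp
  show "dim dirs = d"
    using aff_dim_dim_affine_diffs[OF affine_affine_hull v] dirs_eq[OF v] aff_dim_P by simp
qed

lemma diff_in_dirs: "x \<in> affine hull P \<Longrightarrow> y \<in> affine hull P \<Longrightarrow> x - y \<in> dirs"
  using dirs_eq by blast

lemma normal_in_dirs: "F facet_of P \<Longrightarrow> a F \<in> dirs"
  using normal_parallel by (simp add: dirs_def)

lemma add_in_hull: "x \<in> affine hull P \<Longrightarrow> y \<in> dirs \<Longrightarrow> x + y \<in> affine hull P"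
  by (simp add: dirs_def)

text \<open>Otherwise a small step along \<open>y\<close> in both directions stays in
  \<open>P\<close>: tight inequalities do not change and the others have slack. Then
  \<open>v\<close> is not extreme.\<close>

lemma tight_kernel_trivial:
  assumes v: "v \<in> vertices" and y: "y \<in> dirs" "\<And>F. F \<in> facets_at v \<Longrightarrow> a F \<bullet> y = 0"
  shows "y = 0"
proof (rule ccontr)
  assume "y \<noteq> 0"
  let ?A = "{F. F facet_of P} - facets_at v"
  have vP: "v \<in> P" using v vertex_in_P by blast
  have "finite ?A"
    using finite_polyhedron_facets[OF poly] by simp
  then obtain \<epsilon> where \<epsilon>: "\<epsilon> > 0" "\<forall>F \<in> ?A. \<epsilon> * \<bar>a F \<bullet> y\<bar> \<le> b F - a F \<bullet> v"
    using finite_uniform_scaling[of ?A "\<lambda>F. b F - a F \<bullet> v" "\<lambda>F. a F \<bullet> y"] slack_pos[OF vP] by auto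
  have mem: "v + t *\<^sub>R y \<in> P" if t: "\<bar>t\<bar> = \<epsilon>" for t
  proof -
    have "a F \<bullet> (v + t *\<^sub>R y) \<le> b F" if F: "F facet_of P" for F
    proof (cases "F \<in> facets_at v")
      case True
      then show ?thesis
        using y(2)[OF True] by (simp add: inner_simps facets_at_iff)
    next
      case False
      then have "\<epsilon> * \<bar>a F \<bullet> y\<bar> \<le> b F - a F \<bullet> v"
        using \<epsilon> F by blast
      moreover have "t * (a F \<bullet> y) \<le> \<epsilon> * \<bar>a F \<bullet> y\<bar>"
        using t by (metis abs_ge_self abs_mult)
      ultimately show ?thesis
        by (simp add: inner_simps)
    qed
    moreover have "v + t *\<^sub>R y \<in> affine hull P"
      using add_in_hull in_hull vP subspace_scale[OF subspace_dirs y(1)] by blast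
    ultimately show ?thesis
      using mem_P by blast
  qed
  have "v \<in> open_segment (v + \<epsilon> *\<^sub>R y) (v + (- \<epsilon>) *\<^sub>R y)"
    unfolding in_segment using \<epsilon> \<open>y \<noteq> 0\<close>
    by (intro conjI exI[of _ "1/2"]) (auto simp: algebra_simps simp flip: scaleR_left_distrib)
  moreover have "v + \<epsilon> *\<^sub>R y \<in> P" "v + (- \<epsilon>) *\<^sub>R y \<in> P"
    using mem[of \<epsilon>] mem[of "- \<epsilon>"] \<epsilon> by auto
  ultimately show False
    using v by (auto simp: vertices_def extreme_point_of_def)
qed

text \<open>If \<open>v\<close> lay inside a segment of \<open>P\<close>, every inequality tight at
  \<open>v\<close> would be tight at both ends, so their difference would lie in the kernel.\<close>

lemma vertexI:
  assumes v: "v \<in> P" and ker: "\<And>y. y \<in> dirs \<Longrightarrow> \<forall>F \<in> facets_at v. a F \<bullet> y = 0 \<Longrightarrow> y = 0"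
  shows "v \<in> vertices"
proof -
  have False if xy: "x \<in> P" "y \<in> P" "v \<in> open_segment x y" for x y
  proof -
    obtain u where u: "x \<noteq> y" "0 < u" "u < 1" "v = (1 - u) *\<^sub>R x + u *\<^sub>R y"
      using xy(3) unfolding in_segment by blast
    have "a F \<bullet> (x - y) = 0" if F: "F \<in> facets_at v" for F
    proof -
      have le: "a F \<bullet> x \<le> b F" "a F \<bullet> y \<le> b F" and eq: "a F \<bullet> v = b F"
        using F xy mem_P facets_at_iff by blast+
      have eq': "(1 - u) * (b F - a F \<bullet> x) + u * (b F - a F \<bullet> y) = 0"
        using eq unfolding u(4) by (simp add: inner_simps algebra_simps)
      have "0 \<le> (1 - u) * (b F - a F \<bullet> x)" "0 \<le> u * (b F - a F \<bullet> y)"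
        using le u by auto
      then have "(1 - u) * (b F - a F \<bullet> x) = 0" "u * (b F - a F \<bullet> y) = 0"
        using eq' by linarith+
      then show ?thesis
        using u by (simp add: inner_simps)
    qed
    then have "x - y = 0"
      using ker[OF diff_in_dirs] in_hull xy by blast
    with u show False by simp
  qed
  then show ?thesis
    using v unfolding vertices_def extreme_point_of_def by blast
qed

text \<open>The normals at \<open>v\<close> span \<open>dirs\<close> by
  \<open>tight_kernel_trivial\<close>, and simplicity says there are \<open>d\<close> of them, so
  they form a basis. The dual vector of \<open>F\<close> is the part of \<open>a F\<close>
  orthogonal to the other normals, scaled; the sign makes it point into the halfspace of
  \<open>F\<close>.\<close>

lemma dual_basis_exists:
  assumes v: "v \<in> vertices"
  shows "\<exists>e. \<forall>F \<in> facets_at v. e F \<in> dirs \<and> (\<forall>G \<in> facets_at v. a G \<bullet> e F = (if G = F then - 1 else 0))"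
proof -
  let ?B = "a ` facets_at v"
  have sub: "?B \<subseteq> dirs"
    using normal_in_dirs by (auto simp: facets_at_def)
  have fin: "finite ?B"
    using finite_facets_at by simp
  have span: "dirs \<subseteq> span ?B"
  proof (rule ccontr)
    assume "\<not> dirs \<subseteq> span ?B"
    then have "span ?B \<subset> span dirs"
      using span_mono[OF sub] span_superset by blast
    then obtain y where y: "y \<noteq> 0" "y \<in> span dirs" "\<And>x. x \<in> span ?B \<Longrightarrow> orthogonal y x"
      using orthogonal_to_subspace_exists_gen by metis
    have "y \<in> dirs"
      using y(2) subspace_dirs by (metis span_eq_iff)
    moreover have "a F \<bullet> y = 0" if "F \<in> facets_at v" for F
      using y(3)[OF span_base[of "a F" ?B]] that by (simp add: orthogonal_def inner_commute)
    ultimately show False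
      using tight_kernel_trivial[OF v] y by blast
  qed
  have "d \<le> card ?B"
    using dim_le_card[OF span fin] dim_dirs by simp
  then have card: "card ?B = d"
    using card_image_le[OF finite_facets_at[of v], of a] card_facets_at[OF v] by simp
  then have inj: "inj_on a (facets_at v)"
    using finite_facets_at card_facets_at[OF v] eq_card_imp_inj_on by metis
  have indep: "independent ?B"
    using card_le_dim_spanning[OF sub span fin] card dim_dirs by simp
  have "\<exists>e. e \<in> dirs \<and> (\<forall>G \<in> facets_at v. a G \<bullet> e = (if G = F then - 1 else 0))"
    if F: "F \<in> facets_at v" for F
  proof -
    let ?S = "a ` (facets_at v - {F})"
    obtain y z where yz: "y \<in> span ?S" "\<And>w. w \<in> span ?S \<Longrightarrow> orthogonal z w" "a F = y + z"
      using orthogonal_subspace_decomp_exists[of ?S "a F"] by metis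
    have S: "?S = ?B - {a F}"
      using inj F by (auto simp: inj_on_def)
    have "a F \<notin> span ?S"
      using indep F unfolding S dependent_def by blast
    then have "z \<noteq> 0"
      using yz by auto
    have "?S \<subseteq> dirs"
      using sub by blast
    then have "y \<in> dirs"
      using yz(1) span_minimal[OF _ subspace_dirs] by blast
    moreover have "a F \<in> dirs"
      using sub F by blast
    moreover have "z = a F - y"
      using yz by simp
    ultimately have z: "z \<in> dirs"
      using subspace_diff[OF subspace_dirs] by simp
    have "a F \<bullet> z = z \<bullet> z"
      using yz(2)[OF yz(1)] yz(3) by (simp add: inner_simps orthogonal_def inner_commute)
    moreover have "a G \<bullet> z = 0" if "G \<in> facets_at v" "G \<noteq> F" for G
      using yz(2)[of "a G"] that by (simp add: span_base orthogonal_def inner_commute)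
    ultimately show ?thesis
      using \<open>z \<noteq> 0\<close> subspace_scale[OF subspace_dirs z, of "- 1 / (z \<bullet> z)"]
      by (intro exI[of _ "(- 1 / (z \<bullet> z)) *\<^sub>R z"]) auto
  qed
  then show ?thesis by metis
qed

text \<open>The direction of the edge that leaves \<open>F\<close> and stays on all other facets at
  \<open>v\<close>; the slack of \<open>F\<close> grows along it at unit rate.\<close>

definition edge_dir :: "'a \<Rightarrow> 'a set \<Rightarrow> 'a" where
  "edge_dir v = (SOME e. \<forall>F \<in> facets_at v. e F \<in> dirs \<and>
     (\<forall>G \<in> facets_at v. a G \<bullet> e F = (if G = F then - 1 else 0)))"

lemma edge_dir:
  assumes "v \<in> vertices" "F \<in> facets_at v"
  shows "edge_dir v F \<in> dirs" "G \<in> facets_at v \<Longrightarrow> a G \<bullet> edge_dir v F = (if G = F then - 1 else 0)"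
    "edge_dir v F \<noteq> 0"
proof -
  have *: "\<forall>F \<in> facets_at v. edge_dir v F \<in> dirs \<and>
     (\<forall>G \<in> facets_at v. a G \<bullet> edge_dir v F = (if G = F then - 1 else 0))"
    unfolding edge_dir_def by (rule someI_ex[OF dual_basis_exists[OF assms(1)]])
  then show "edge_dir v F \<in> dirs" "G \<in> facets_at v \<Longrightarrow> a G \<bullet> edge_dir v F = (if G = F then - 1 else 0)"
    using assms(2) by blast+
  show "edge_dir v F \<noteq> 0"
    using * assms(2) by force
qed

text \<open>The slacks are coordinates for the basis of edge directions: the difference of both
  sides is annihilated by every normal at \<open>v\<close>.\<close>

lemma vertex_coordinates:
  assumes v: "v \<in> vertices" and x: "x \<in> affine hull P"
  shows "x = v + (\<Sum>F \<in> facets_at v. (b F - a F \<bullet> x) *\<^sub>R edge_dir v F)"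
proof -
  let ?s = "\<Sum>F \<in> facets_at v. (b F - a F \<bullet> x) *\<^sub>R edge_dir v F"
  have "?s \<in> dirs"
    using edge_dir(1)[OF v] subspace_dirs by (intro subspace_sum subspace_scale) auto
  then have "x - v - ?s \<in> dirs"
    using diff_in_dirs[OF x in_hull[OF vertex_in_P[OF v]]] subspace_diff[OF subspace_dirs] by blast
  moreover have "a G \<bullet> (x - v - ?s) = 0" if G: "G \<in> facets_at v" for G
  proof -
    have "a G \<bullet> ?s = (\<Sum>F \<in> facets_at v. if F = G then - (b F - a F \<bullet> x) else 0)"
      unfolding inner_sum_right using edge_dir(2)[OF v _ G] by (intro sum.cong) auto
    also have "\<dots> = a G \<bullet> x - b G"
      using G finite_facets_at by (simp add: sum.delta)
    finally show ?thesis
      using G by (simp add: inner_diff_right facets_at_iff)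
  qed
  ultimately have "x - v - ?s = 0"
    using tight_kernel_trivial[OF v] by blast
  then show ?thesis by (simp add: algebra_simps)
qed

lemma edge_line:
  assumes "v \<in> vertices" "x \<in> affine hull P" "F \<in> facets_at v" "facets_at v - {F} \<subseteq> facets_at x"
  shows "x = v + (b F - a F \<bullet> x) *\<^sub>R edge_dir v F"
proof -
  have "(\<Sum>G \<in> facets_at v. (b G - a G \<bullet> x) *\<^sub>R edge_dir v G) =
      (\<Sum>G \<in> {F}. (b G - a G \<bullet> x) *\<^sub>R edge_dir v G)"
    using assms finite_facets_at by (intro sum.mono_neutral_right) (auto simp: facets_at_iff)
  then show ?thesis
    using vertex_coordinates[OF assms(1,2)] by simp
qed

lemma facets_at_inj:
  assumes "x \<in> vertices" "y \<in> vertices" "facets_at x \<subseteq> facets_at y"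
  shows "x = y"
proof -
  have "(\<Sum>G \<in> facets_at x. (b G - a G \<bullet> y) *\<^sub>R edge_dir x G) = 0"
    using assms(3) by (intro sum.neutral) (auto simp: facets_at_iff)
  then show ?thesis
    using vertex_coordinates[OF assms(1) in_hull[OF vertex_in_P[OF assms(2)]]] by simp
qed

text \<open>Both lie on one ray from \<open>x\<close>, so the nearer of two different ones would be
  interior to a segment of \<open>P\<close>.\<close>

lemma edge_two_vertices:
  assumes V: "x \<in> vertices" "y \<in> vertices" "z \<in> vertices" and F: "F \<in> facets_at x"
    and sub: "facets_at x - {F} \<subseteq> facets_at y" "facets_at x - {F} \<subseteq> facets_at z"
    and ne: "y \<noteq> x" "z \<noteq> x"
  shows "y = z"
proof -
  define e where "e = edge_dir x F"
  define s where "s w = b F - a F \<bullet> w" for w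
  have *: "w = x + s w *\<^sub>R e \<and> 0 < s w" if "w \<in> vertices" "facets_at x - {F} \<subseteq> facets_at w" "w \<noteq> x" for w
  proof -
    have "w = x + s w *\<^sub>R e"
      unfolding e_def s_def using edge_line[OF V(1) in_hull[OF vertex_in_P[OF that(1)]] F that(2)] .
    moreover have "0 \<le> s w"
      using mem_P[of w] vertex_in_P[OF that(1)] F by (simp add: s_def facets_at_iff)
    moreover have "s w \<noteq> 0"
      using calculation(1) that(3) by (metis add.right_neutral scaleR_zero_left)
    ultimately show ?thesis by simp
  qed
  have between: False
    if "w \<in> vertices" "w = x + s w *\<^sub>R e" "u = x + s u *\<^sub>R e" "u \<in> vertices" "0 < s w" "s w < s u" for w u
  proof -
    have "e \<noteq> 0"
      using edge_dir(3)[OF V(1) F] by (simp add: e_def)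
    then have "x \<noteq> u"
      using that by auto
    moreover have "w = (1 - s w / s u) *\<^sub>R x + (s w / s u) *\<^sub>R u"
    proof -
      have "(1 - s w / s u) *\<^sub>R x + (s w / s u) *\<^sub>R u = x + (s w / s u) *\<^sub>R (u - x)"
        by (simp add: algebra_simps)
      also have "u - x = s u *\<^sub>R e"
        using that(3) by (simp add: algebra_simps)
      finally show ?thesis
        using that by simp
    qed
    ultimately have "w \<in> open_segment x u"
      unfolding in_segment using that by (intro conjI exI[of _ "s w / s u"]) auto
    then show False
      using that V(1) vertex_in_P unfolding vertices_def extreme_point_of_def by blast
  qed
  have "s y = s z"
    using between[of y z] between[of z y] *[OF V(2) sub(1) ne(1)] *[OF V(3) sub(2) ne(2)] V
    by (metis linorder_neqE_linordered_idom)
  then show ?thesis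
    using *[OF V(2) sub(1) ne(1)] *[OF V(3) sub(2) ne(2)] by metis
qed

lemma ray_in_P:
  assumes v: "v \<in> vertices" and F: "F \<in> facets_at v"
    and rec: "\<And>G. G facet_of P \<Longrightarrow> a G \<bullet> edge_dir v F \<le> 0" and t: "0 \<le> t"
  shows "v + t *\<^sub>R edge_dir v F \<in> P"
proof -
  have "a G \<bullet> (v + t *\<^sub>R edge_dir v F) \<le> b G" if "G facet_of P" for G
    using rec[OF that] t mem_P[of v] vertex_in_P[OF v] that mult_nonneg_nonpos[of t "a G \<bullet> edge_dir v F"]
    by (fastforce simp: inner_simps)
  moreover have "v + t *\<^sub>R edge_dir v F \<in> affine hull P"
    using add_in_hull in_hull vertex_in_P[OF v] subspace_scale[OF subspace_dirs edge_dir(1)[OF v F]] by blast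
  ultimately show ?thesis
    using mem_P by blast
qed

text \<open>A simplex pivot. The ratio test finds the first facet \<open>G\<close> hit along the
  edge; the facets kept from \<open>v\<close> leave only the line of the edge as kernel, and
  \<open>G\<close> is transversal to it, so the end point is a vertex.\<close>

lemma pivot:
  assumes v: "v \<in> vertices" and F: "F \<in> facets_at v" and K: "K facet_of P" "0 < a K \<bullet> edge_dir v F"
  shows "\<exists>t>0. v + t *\<^sub>R edge_dir v F \<in> vertices \<and>
           facets_at v - {F} \<subseteq> facets_at (v + t *\<^sub>R edge_dir v F)"
proof -
  define e where "e = edge_dir v F"
  have e: "e \<in> dirs" "\<And>G. G \<in> facets_at v \<Longrightarrow> a G \<bullet> e = (if G = F then - 1 else 0)"
    using edge_dir[OF v F] by (auto simp: e_def)
  have vP: "v \<in> P"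
    using vertex_in_P v .
  define T where "T = {G. G facet_of P \<and> 0 < a G \<bullet> e}"
  have "finite T" "T \<noteq> {}"
    using finite_polyhedron_facets[OF poly] K by (auto simp: T_def e_def)
  define r where "r G = (b G - a G \<bullet> v) / (a G \<bullet> e)" for G
  obtain G where G: "G \<in> T" "\<And>H. H \<in> T \<Longrightarrow> r G \<le> r H"
    using finite_ex_min[OF \<open>finite T\<close> \<open>T \<noteq> {}\<close>, of r] by blast
  have GP: "G facet_of P" "0 < a G \<bullet> e"
    using G by (auto simp: T_def)
  have "G \<notin> facets_at v"
    using e(2)[of G] GP by (auto split: if_splits)
  then have r: "0 < r G"
    using slack_pos[OF vP GP(1)] GP by (simp add: r_def)
  define w where "w = v + r G *\<^sub>R e"
  have aw: "a H \<bullet> w = a H \<bullet> v + r G * (a H \<bullet> e)" for H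
    by (simp add: w_def inner_simps)
  have "a H \<bullet> w \<le> b H" if H: "H facet_of P" for H
  proof (cases "H \<in> T")
    case True
    then have "r G \<le> (b H - a H \<bullet> v) / (a H \<bullet> e)" "0 < a H \<bullet> e"
      using G(2)[OF True] by (auto simp: r_def T_def)
    then show ?thesis
      by (simp add: aw pos_le_divide_eq)
  next
    case False
    then have "r G * (a H \<bullet> e) \<le> 0"
      using H r by (simp add: T_def mult_nonneg_nonpos)
    moreover have "a H \<bullet> v \<le> b H"
      using mem_P vP H by blast
    ultimately show ?thesis
      by (simp add: aw)
  qed
  moreover have "w \<in> affine hull P"
    unfolding w_def using add_in_hull in_hull vP subspace_scale[OF subspace_dirs e(1)] by blast
  ultimately have wP: "w \<in> P"
    using mem_P by blast
  have Gw: "G \<in> facets_at w"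
    using GP wP by (simp add: facets_at_iff aw r_def)
  have sub: "facets_at v - {F} \<subseteq> facets_at w"
  proof
    fix H assume "H \<in> facets_at v - {F}"
    then have H: "H \<in> facets_at v" "a H \<bullet> e = 0"
      using e(2)[of H] by auto
    then show "H \<in> facets_at w"
      using wP by (simp add: facets_at_iff aw)
  qed
  have "w \<in> vertices"
  proof (rule vertexI[OF wP])
    fix y assume y: "y \<in> dirs" "\<forall>F \<in> facets_at w. a F \<bullet> y = 0"
    \<comment> \<open>As \<open>a F \<bullet> e = - 1\<close>, this multiple of \<open>e\<close>
      cancels the component of \<open>y\<close> along \<open>F\<close>.\<close>
    have ker: "a H \<bullet> (y + (a F \<bullet> y) *\<^sub>R e) = 0" if H: "H \<in> facets_at v" for H
    proof (cases "H = F")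
      case True
      then show ?thesis
        using e(2)[OF H] by (simp add: inner_add_right)
    next
      case False
      then have "a H \<bullet> y = 0"
        using y(2) sub H by blast
      then show ?thesis
        using e(2)[OF H] False by (simp add: inner_add_right)
    qed
    moreover have "y + (a F \<bullet> y) *\<^sub>R e \<in> dirs"
      using y e subspace_dirs by (intro subspace_add subspace_scale) auto
    ultimately have "y + (a F \<bullet> y) *\<^sub>R e = 0"
      using tight_kernel_trivial[OF v] by blast
    then have y_eq: "y = - (a F \<bullet> y) *\<^sub>R e"
      by (simp add: eq_neg_iff_add_eq_0)
    have "a G \<bullet> y = 0"
      using y Gw by blast
    then have "(a F \<bullet> y) * (a G \<bullet> e) = 0"
      by (metis y_eq inner_scaleR_right mult_minus_left neg_equal_0_iff_equal)
    then show "y = 0"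
      using GP y_eq by auto
  qed
  then show ?thesis
    using r sub by (auto simp: w_def e_def)
qed

section \<open>A generic linear function positive on recession directions\<close>

text \<open>Take minus a positive combination of the normals at \<open>v\<close>. Each normal is
  nonpositive on a recession direction and one is nonzero there; bounded values of \<open>c\<close>
  bound every slack at \<open>v\<close>. Generic weights separate the vertices.\<close>

lemma generic_objective_exists:
  assumes v: "v \<in> vertices"
  shows "\<exists>c. inj_on ((\<bullet>) c) vertices
    \<and> (\<forall>e \<in> dirs. e \<noteq> 0 \<longrightarrow> (\<forall>F. F facet_of P \<longrightarrow> a F \<bullet> e \<le> 0) \<longrightarrow> 0 < c \<bullet> e)
    \<and> (\<forall>M. bounded {x \<in> P. c \<bullet> x \<le> M})"
proof -
  let ?A = "facets_at v"
  define D where "D = (\<lambda>(x, y). x - y) ` (vertices \<times> vertices) - {0}"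
  have "finite D"
    using finite_polyhedron_extreme_points[OF poly] by (simp add: D_def vertices_def)
  moreover have D_dirs: "D \<subseteq> dirs"
    using diff_in_dirs in_hull vertex_in_P by (auto simp: D_def)
  have "\<exists>F \<in> ?A. a F \<bullet> y \<noteq> 0" if "y \<in> D" for y
    using tight_kernel_trivial[OF v, of y] that D_dirs by (auto simp: D_def)
  ultimately obtain w where w: "\<And>F. F \<in> ?A \<Longrightarrow> 0 < w F"
      and wD: "\<And>y. y \<in> D \<Longrightarrow> (\<Sum>F \<in> ?A. w F * (a F \<bullet> y)) \<noteq> 0"
    using generic_weights[of ?A D "\<lambda>F y. a F \<bullet> y"] finite_facets_at by blast
  define c where "c = - (\<Sum>F \<in> ?A. w F *\<^sub>R a F)"
  have c: "c \<bullet> y = - (\<Sum>F \<in> ?A. w F * (a F \<bullet> y))" for y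
    by (simp add: c_def inner_sum_left)
  have "inj_on ((\<bullet>) c) vertices"
  proof (rule inj_onI, rule ccontr)
    fix x y assume xy: "x \<in> vertices" "y \<in> vertices" "c \<bullet> x = c \<bullet> y" "x \<noteq> y"
    then have "x - y \<in> D"
      by (auto simp: D_def)
    then have "c \<bullet> (x - y) \<noteq> 0"
      using wD by (simp add: c)
    then show False
      using xy by (simp add: inner_diff_right)
  qed
  moreover have "0 < c \<bullet> e" if e: "e \<in> dirs" "e \<noteq> 0" "\<forall>F. F facet_of P \<longrightarrow> a F \<bullet> e \<le> 0" for e
  proof -
    obtain G where G: "G \<in> ?A" "a G \<bullet> e \<noteq> 0"
      using tight_kernel_trivial[OF v e(1)] e(2) by blast
    have nonpos: "a F \<bullet> e \<le> 0" if "F \<in> ?A" for F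
      using e(3) that by (simp add: facets_at_iff)
    have "0 < (\<Sum>F \<in> ?A. w F * - (a F \<bullet> e))"
    proof (rule sum_pos2[OF finite_facets_at G(1)])
      show "0 < w G * - (a G \<bullet> e)"
        using w[OF G(1)] nonpos[OF G(1)] G(2) by (intro mult_pos_pos) auto
      show "0 \<le> w F * - (a F \<bullet> e)" if "F \<in> ?A" for F
        using w[OF that] nonpos[OF that] by (intro mult_nonneg_nonneg) auto
    qed
    then show ?thesis
      by (simp add: c sum_negf)
  qed
  moreover have "bounded {x \<in> P. c \<bullet> x \<le> M}" for M
  proof -
    \<comment> \<open>The weighted slacks sum to at most \<open>K\<close>, so each coordinate of
      \<open>x\<close> at \<open>v\<close> is at most \<open>K / w F\<close>.\<close>
    define K where "K = (\<Sum>F \<in> ?A. w F * b F) + M"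
    define B where "B = norm v + (\<Sum>F \<in> ?A. (K / w F) * norm (edge_dir v F))"
    have "norm x \<le> B" if x: "x \<in> P" "c \<bullet> x \<le> M" for x
    proof -
      have pos: "0 \<le> b F - a F \<bullet> x" if "F \<in> ?A" for F
        using x mem_P[of x] that by (simp add: facets_at_iff)
      have le: "b F - a F \<bullet> x \<le> K / w F" if F: "F \<in> ?A" for F
      proof -
        have "w F * (b F - a F \<bullet> x) \<le> (\<Sum>F \<in> ?A. w F * (b F - a F \<bullet> x))"
        proof (rule member_le_sum[OF F _ finite_facets_at])
          show "0 \<le> w G * (b G - a G \<bullet> x)" if "G \<in> ?A - {F}" for G
            using pos[of G] w[of G] that by (intro mult_nonneg_nonneg) auto
        qed
        also have "\<dots> = (\<Sum>F \<in> ?A. w F * b F) + c \<bullet> x"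
          by (simp add: c right_diff_distrib sum_subtractf)
        also have "\<dots> \<le> K"
          using x by (simp add: K_def)
        finally show ?thesis
          using w[OF F] by (simp add: pos_le_divide_eq mult.commute)
      qed
      have "norm x = norm (v + (\<Sum>F \<in> ?A. (b F - a F \<bullet> x) *\<^sub>R edge_dir v F))"
        using vertex_coordinates[OF v in_hull[OF x(1)]] by simp
      also have "\<dots> \<le> norm v + norm (\<Sum>F \<in> ?A. (b F - a F \<bullet> x) *\<^sub>R edge_dir v F)"
        by (rule norm_triangle_ineq)
      also have "\<dots> \<le> norm v + (\<Sum>F \<in> ?A. norm ((b F - a F \<bullet> x) *\<^sub>R edge_dir v F))"
        by (intro add_left_mono norm_sum)
      also have "\<dots> \<le> B"
        unfolding B_def norm_scaleR
        using pos le by (intro add_left_mono sum_mono mult_right_mono) auto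
      finally show ?thesis .
    qed
    then show ?thesis
      by (intro boundedI[of _ B]) auto
  qed
  ultimately show ?thesis by blast
qed

lemma objective_expansion:
  assumes "v \<in> vertices" "x \<in> P"
  shows "c \<bullet> x = c \<bullet> v + (\<Sum>F \<in> facets_at v. (b F - a F \<bullet> x) * (c \<bullet> edge_dir v F))"
  using arg_cong[OF vertex_coordinates[OF assms(1) in_hull[OF assms(2)]], of "(\<bullet>) c"]
  by (simp add: inner_add_right inner_sum_right)

lemma slack_nonneg: "x \<in> P \<Longrightarrow> F \<in> facets_at v \<Longrightarrow> 0 \<le> b F - a F \<bullet> x"
  using mem_P[of x] by (simp add: facets_at_iff)

end

section \<open>Boundedness\<close>

text \<open>\<open>c_recession\<close> gives every descending edge a second vertex;
  \<open>c_sublevel\<close> makes \<open>P\<close> bounded once \<open>c\<close> is bounded above on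
  it.\<close>

locale simple_simplicial_polyhedron = simple_facet_presentation +
  fixes c :: 'a
  assumes d_ge_2: "2 \<le> d"
    and simplicial_P: "F facet_of P \<Longrightarrow> card {v. v extreme_point_of P \<and> v \<in> F} = d"
    and c_inj: "inj_on ((\<bullet>) c) vertices"
    and c_recession: "\<lbrakk>e \<in> dirs; e \<noteq> 0; \<And>F. F facet_of P \<Longrightarrow> a F \<bullet> e \<le> 0\<rbrakk> \<Longrightarrow> 0 < c \<bullet> e"
    and c_sublevel: "bounded {x \<in> P. c \<bullet> x \<le> M}"
begin

text \<open>In the coordinates at \<open>w\<close>, some edge direction with positive slack at
  \<open>x\<close> decreases \<open>c\<close>. Its facet is not in \<open>S\<close> because
  \<open>x\<close> lies on \<open>S\<close>, and \<open>pivot\<close> provides the end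
  vertex.\<close>

lemma descent_edge:
  assumes w: "w \<in> vertices" and x: "x \<in> vertices" and S: "S \<subseteq> facets_at w" "S \<subseteq> facets_at x"
    and less: "c \<bullet> x < c \<bullet> w"
  shows "\<exists>w' \<in> vertices. \<exists>F \<in> facets_at w. facets_at w - {F} \<subseteq> facets_at w' \<and> S \<subseteq> facets_at w'
           \<and> c \<bullet> w' < c \<bullet> w"
proof -
  have xP: "x \<in> P" using vertex_in_P x .
  have "(\<Sum>F \<in> facets_at w. (b F - a F \<bullet> x) * (c \<bullet> edge_dir w F)) < 0"
    using objective_expansion[OF w xP, of c] less by simp
  then obtain F where F: "F \<in> facets_at w" "(b F - a F \<bullet> x) * (c \<bullet> edge_dir w F) < 0"
    by (meson not_le sum_nonneg)
  have slack: "0 < b F - a F \<bullet> x" and neg: "c \<bullet> edge_dir w F < 0"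
    using F(2) slack_nonneg[OF xP F(1)] by (auto simp: mult_less_0_iff)
  have "F \<notin> S"
    using S slack by (auto simp: facets_at_iff)
  have "\<exists>K. K facet_of P \<and> 0 < a K \<bullet> edge_dir w F"
    using c_recession[OF edge_dir(1,3)[OF w F(1)]] neg by (meson not_le order.asym)
  then obtain t where t: "0 < t" "w + t *\<^sub>R edge_dir w F \<in> vertices"
      "facets_at w - {F} \<subseteq> facets_at (w + t *\<^sub>R edge_dir w F)"
    using pivot[OF w F(1)] by blast
  have "c \<bullet> (w + t *\<^sub>R edge_dir w F) < c \<bullet> w"
    using t(1) neg by (simp add: inner_add_right mult_pos_neg)
  moreover have "S \<subseteq> facets_at (w + t *\<^sub>R edge_dir w F)"
    using t(3) S(1) \<open>F \<notin> S\<close> by blast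
  ultimately show ?thesis
    using t F(1) by blast
qed

sublocale incidence: simple_simplicial_incidence vertices facets_at d "(\<bullet>) c"
proof
  show "finite vertices"
    using finite_polyhedron_extreme_points[OF poly] by (simp add: vertices_def)
  show "card {x \<in> vertices. F \<in> facets_at x} = d" if "v \<in> vertices" "F \<in> facets_at v" for v F
    using simplicial_P[of F] that by (simp add: vertices_def facets_at_def)
qed (fact d_ge_2 card_facets_at facets_at_inj edge_two_vertices c_inj descent_edge)+

text \<open>An edge without a second vertex is a ray in the face, and \<open>c\<close> is unbounded
  along it.\<close>

lemma full_face_if_bounded_above:
  assumes M: "\<And>x. x \<in> P \<Longrightarrow> S \<subseteq> facets_at x \<Longrightarrow> c \<bullet> x \<le> M"
  shows "incidence.full_face S"
  unfolding incidence.full_face_def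
proof (intro ballI)
  fix v H assume "v \<in> incidence.verts_on S" and H: "H \<in> facets_at v - S"
  then have v: "v \<in> vertices" "S \<subseteq> facets_at v"
    by (auto simp: incidence.verts_on_def)
  have HF: "H \<in> facets_at v"
    using H by simp
  define e where "e = edge_dir v H"
  have "\<exists>K. K facet_of P \<and> 0 < a K \<bullet> e"
  proof (rule ccontr)
    assume "\<not> ?thesis"
    then have rec: "\<And>K. K facet_of P \<Longrightarrow> a K \<bullet> e \<le> 0"
      by (meson not_le)
    then have pos: "0 < c \<bullet> e"
      unfolding e_def using c_recession edge_dir[OF v(1) HF] by blast
    \<comment> \<open>Chosen so that \<open>c\<close> takes the value
      \<open>M + c \<bullet> e\<close> there, just beyond the bound.\<close>
    define t where "t = (M - c \<bullet> v) / (c \<bullet> e) + 1"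
    have "c \<bullet> v \<le> M"
      using M vertex_in_P v by blast
    then have t: "0 \<le> t"
      using pos by (simp add: t_def)
    have P: "v + t *\<^sub>R e \<in> P"
      using ray_in_P[OF v(1) HF _ t] rec by (simp add: e_def)
    have "S \<subseteq> facets_at (v + t *\<^sub>R e)"
    proof
      fix G assume G: "G \<in> S"
      then have Gv: "G \<in> facets_at v" and "G \<noteq> H"
        using v H by auto
      then have "a G \<bullet> e = 0"
        using edge_dir(2)[OF v(1) HF Gv] by (simp add: e_def)
      then show "G \<in> facets_at (v + t *\<^sub>R e)"
        using Gv P by (simp add: facets_at_iff inner_add_right)
    qed
    then have "c \<bullet> (v + t *\<^sub>R e) \<le> M"
      using M P by blast
    moreover have "c \<bullet> (v + t *\<^sub>R e) = M + c \<bullet> e"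
      using pos by (simp add: t_def inner_add_right distrib_right)
    ultimately show False
      using pos by simp
  qed
  then obtain t where t: "0 < t" "v + t *\<^sub>R e \<in> vertices" "facets_at v - {H} \<subseteq> facets_at (v + t *\<^sub>R e)"
    using pivot[OF v(1) HF] unfolding e_def by blast
  have "v \<noteq> v + t *\<^sub>R e"
    using t(1) edge_dir(3)[OF v(1) HF] by (simp add: e_def)
  then show "\<exists>x. incidence.adj v x \<and> facets_at v - {H} \<subseteq> facets_at x"
    unfolding incidence.adj_def using t v HF by blast
qed

text \<open>On the face of \<open>S\<close>, facets in \<open>S\<close> contribute no slack and
  every other facet at \<open>w\<close> has a descending edge direction, so \<open>w\<close> is its
  top vertex. If \<open>S\<close> were empty, \<open>P\<close> would be a sublevel set of
  \<open>c\<close>.\<close>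

lemma bounded_if_vertex:
  assumes "v \<in> vertices"
  shows "bounded P"
proof (rule ccontr)
  assume unb: "\<not> bounded P"
  show False
  proof (rule incidence.unbounded_incidence_impossible[OF _ assms])
    fix w S assume w: "w \<in> vertices"
      and S: "S = {F \<in> facets_at w. \<forall>x \<in> incidence.lower_nbrs w. \<not> facets_at w - {F} \<subseteq> facets_at x}"
    have top: "c \<bullet> x \<le> c \<bullet> w" if x: "x \<in> P" "S \<subseteq> facets_at x" for x
    proof -
      have "(b F - a F \<bullet> x) * (c \<bullet> edge_dir w F) \<le> 0" if F: "F \<in> facets_at w" for F
      proof (cases "F \<in> S")
        case True
        then show ?thesis
          using x by (auto simp: facets_at_iff)
      next
        case False
        then obtain y where y: "y \<in> incidence.lower_nbrs w" "facets_at w - {F} \<subseteq> facets_at y"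
          using S F by blast
        then have "y \<in> vertices" and less: "c \<bullet> y < c \<bullet> w"
          by (auto simp: incidence.lower_nbrs_def incidence.adj_def)
        then have yP: "y \<in> P"
          using vertex_in_P by blast
        have "y = w + (b F - a F \<bullet> y) *\<^sub>R edge_dir w F"
          using edge_line[OF w in_hull[OF yP] F y(2)] .
        then have "c \<bullet> y = c \<bullet> w + (b F - a F \<bullet> y) * (c \<bullet> edge_dir w F)"
          by (metis inner_add_right inner_scaleR_right)
        then have "(b F - a F \<bullet> y) * (c \<bullet> edge_dir w F) < 0"
          using less by simp
        then have "c \<bullet> edge_dir w F < 0"
          using slack_nonneg[OF yP F] by (auto simp: mult_less_0_iff)
        then show ?thesis
          using slack_nonneg[OF x(1) F] by (simp add: mult_nonneg_nonpos)
      qed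
      then show ?thesis
        using objective_expansion[OF w x(1), of c] by (simp add: sum_nonpos)
    qed
    have "S \<noteq> {}"
    proof
      assume "S = {}"
      then have "P \<subseteq> {x \<in> P. c \<bullet> x \<le> c \<bullet> w}"
        using top by blast
      then show False
        using c_sublevel bounded_subset unb by blast
    qed
    then show "S \<noteq> {} \<and> incidence.full_face S"
      using full_face_if_bounded_above top by blast
  qed
qed

text \<open>A polytope is the convex hull of its vertices, and \<open>d + 1\<close> points spanning
  dimension \<open>d\<close> are affinely independent.\<close>

lemma simplex_if_vertex:
  assumes "v \<in> vertices" "3 \<le> d"
  shows "int d simplex P"
proof -
  have bdd: "bounded P"
    using bounded_if_vertex assms by blast
  then obtain B where B: "\<And>x. x \<in> P \<Longrightarrow> norm x \<le> B"
    unfolding bounded_iff by blast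
  have "c \<bullet> x \<le> norm c * B" if "x \<in> P" for x
    using norm_cauchy_schwarz[of c x] B[OF that] by (meson mult_left_mono norm_ge_zero order_trans)
  then have "incidence.full_face {}"
    using full_face_if_bounded_above by blast
  then have card: "card vertices = Suc d"
    using incidence.card_V_if_edges_bounded assms by blast
  have P: "P = convex hull vertices"
    unfolding vertices_def using bdd poly
    by (intro Krein_Milman_Minkowski) (auto simp: compact_eq_bounded_closed polyhedron_imp_closed polyhedron_imp_convex)
  then have "aff_dim vertices = int d"
    using aff_dim_P by (metis aff_dim_convex_hull)
  then have "\<not> affine_dependent vertices"
    using card incidence.finite_V by (simp add: affine_independent_iff_card)
  then show ?thesis
    unfolding simplex_def using card P by auto
qed

end

theorem mainTheorem1:
  fixes d :: nat
  assumes "2 \<le> d"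
  shows "(\<forall>P :: 'a::euclidean_space set.
            dim_polyhedron d P \<and> simple_polyhedron P \<and> simplicial_polyhedron P
              \<longrightarrow> int d simplex P \<or> (d = 2 \<and> polygon P))
       \<and> \<not> (\<exists>P :: 'a set.
            dim_polyhedron d P \<and> \<not> bounded P \<and> simple_polyhedron P \<and> simplicial_polyhedron P)"
proof -
  \<comment> \<open>Boundedness alone settles both the polygon case and the second claim.\<close>
  have main: "bounded P \<and> (3 \<le> d \<longrightarrow> int d simplex P)"
    if P: "dim_polyhedron d P" "simple_polyhedron P" "simplicial_polyhedron P" for P :: "'a set"
  proof -
    have poly: "polyhedron P" and dim: "aff_dim P = int d" and "\<exists>v. v extreme_point_of P"
      using P(1) by (auto simp: dim_polyhedron_def pointed_def)
    then obtain v where v: "v extreme_point_of P"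
      by blast
    obtain a b where ab:
        "\<And>x. x \<in> P \<longleftrightarrow> x \<in> affine hull P \<and> (\<forall>F. F facet_of P \<longrightarrow> a F \<bullet> x \<le> b F)"
        "\<And>F. F facet_of P \<Longrightarrow> F = {x \<in> P. a F \<bullet> x = b F}"
        "\<And>F x. F facet_of P \<Longrightarrow> x \<in> affine hull P \<Longrightarrow> x + a F \<in> affine hull P"
      using polyhedron_facet_representation[OF poly] by blast
    have simple: "card {F. F facet_of P \<and> v \<in> F} = d" if "v extreme_point_of P" for v
      using P(2) dim that by (simp add: simple_polyhedron_def)
    have simplicial: "card {v. v extreme_point_of P \<and> v \<in> F} = d" if "F facet_of P" for F
      using P(3) dim that by (simp add: simplicial_polyhedron_def)
    interpret pp: simple_facet_presentation P d a b
      by unfold_locales (fact poly dim simple ab)+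
    have v': "v \<in> pp.vertices"
      using v by (simp add: pp.vertices_def)
    obtain c where c: "inj_on ((\<bullet>) c) pp.vertices"
        "\<forall>e \<in> pp.dirs. e \<noteq> 0 \<longrightarrow> (\<forall>F. F facet_of P \<longrightarrow> a F \<bullet> e \<le> 0) \<longrightarrow> 0 < c \<bullet> e"
        "\<forall>M. bounded {x \<in> P. c \<bullet> x \<le> M}"
      using pp.generic_objective_exists[OF v'] by blast
    interpret sp: simple_simplicial_polyhedron P d a b c
      by unfold_locales (use assms simplicial c in auto)
    show ?thesis
      using sp.bounded_if_vertex sp.simplex_if_vertex v' by blast
  qed
  have "int d simplex P \<or> (d = 2 \<and> polygon P)"
    if P: "dim_polyhedron d P" "simple_polyhedron P" "simplicial_polyhedron P" for P :: "'a set"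
  proof (cases "d = 2")
    case True
    then show ?thesis
      using main[OF P] P(1) by (simp add: polygon_def dim_polyhedron_def polytope_eq_bounded_polyhedron)
  next
    case False
    then show ?thesis
      using main[OF P] assms by simp
  qed
  with main show ?thesis by blast
qed

end
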